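(* Let $\gamma\in(0,1)$ and let $\rho(w,t)$ be a solution of the modified Yard-Sale Model equation $$\frac{\partial \rho(w,t)}{\partial t}=\frac{\partial^2}{\partial w^2}\Big[D[w,\rho(\cdot,t)]\,\rho(w,t)\Big],\qquad D[w,\rho(\cdot,t)]:=\frac{\gamma}{2}\int_0^\infty \kappa(w,x)\rho(x,t)\,dx,$$ where $\kappa(w,x)=(w\wedge x)^2$ if $w\wedge x<1$ and $\kappa(w,x)=w\wedge x$ if $w\wedge x\ge 1$. Then the Gini coefficient $$G(t):=1-\int_0^\infty\int_0^\infty (w\wedge x)\,\rho(w,t)\rho(x,t)\,dx\,dw$$ is monotone increasing (in the non-strict sense, $\frac{dG}{dt}\ge 0$) as a function of $t$.
   Context: Here $w\wedge x:=\min(w,x)$ and $\mathbb{R}^+$ is the positive half-line. For each $t$, $\rho(\cdot,t)$ is a probability density on $\mathbb{R}^+$ (the distribution of agents in dimensionless wealth $w$, all wealths positive) normalized to have unit zeroth and first moments: $\int_0^\infty\rho(w,t)\,dw=1$ and $\int_0^\infty w\,\rho(w,t)\,dw=1$; both moments are conserved by the dynamics. *)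

theory Defs
  imports "HOL-Analysis.Analysis"
begin

definition kappa :: "real \<Rightarrow> real \<Rightarrow> real" where
  "kappa w x = (if min w x < 1 then (min w x)\<^sup>2 else min w x)"

definition diffusion :: "real \<Rightarrow> (real \<Rightarrow> real) \<Rightarrow> real \<Rightarrow> real" where
  "diffusion \<gamma> p w = \<gamma> / 2 * (LINT x:{0<..}|lborel. kappa w x * p x)"

definition gini :: "(real \<Rightarrow> real) \<Rightarrow> real" where
  "gini p = 1 - (LINT w:{0<..}|lborel. (LINT x:{0<..}|lborel. min w x * p w * p x))"

definition wealth_density :: "(real \<Rightarrow> real) \<Rightarrow> bool" where
  "wealth_density p \<longleftrightarrow>
     (\<forall>w>0. p w \<ge> 0) \<and>
     set_integrable lborel {0<..} p \<and>
     (LINT w:{0<..}|lborel. p w) = 1 \<and>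
     set_integrable lborel {0<..} (\<lambda>w. w * p w) \<and>
     (LINT w:{0<..}|lborel. w * p w) = 1"

text \<open>
  Classical solutions on a time interval \<open>T\<close>, with \<open>\<rho> w t\<close> the density at wealth \<open>w\<close> and
  time \<open>t\<close>. The witnesses \<open>\<rho>t\<close> and \<open>J\<close> are the time derivative of \<open>\<rho>\<close> and the first
  \<open>w\<close>-derivative of the product of the diffusion coefficient and \<open>\<rho>\<close>. Only this product, not
  \<open>\<rho>\<close> itself, is required to be twice differentiable in \<open>w\<close>: the slope of \<open>kappa\<close> jumps
  where \<open>min w x = 1\<close>, so the diffusion coefficient, and hence \<open>\<rho>\<close>, generally has a kink at
  \<open>w = 1\<close>. At an end point that belongs to \<open>T\<close> only continuity is required. There is no
  separate boundary condition at \<open>w = 0\<close> or at infinity; conservation of the two moments is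
  part of \<open>wealth_density\<close> at every time.
\<close>
definition modified_ysm_solution :: "real \<Rightarrow> real set \<Rightarrow> (real \<Rightarrow> real \<Rightarrow> real) \<Rightarrow> bool" where
  "modified_ysm_solution \<gamma> T \<rho> \<longleftrightarrow>
     (\<forall>t\<in>T. wealth_density (\<lambda>w. \<rho> w t)) \<and>
     continuous_on ({0<..} \<times> T) (\<lambda>(w, t). \<rho> w t) \<and>
     (\<exists>\<rho>t J.
        continuous_on ({0<..} \<times> interior T) (\<lambda>(w, t). \<rho>t w t) \<and>
        (\<forall>w>0. \<forall>t\<in>interior T.
           ((\<lambda>s. \<rho> w s) has_real_derivative \<rho>t w t) (at t) \<and>
           ((\<lambda>v. diffusion \<gamma> (\<lambda>x. \<rho> x t) v * \<rho> v t) has_real_derivative J w t) (at w) \<and>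
           ((\<lambda>v. J v t) has_real_derivative \<rho>t w t) (at w)))"

end

theory Submission
  imports Defs
begin

text \<open>
  Let \<open>S w t\<close> be the mass above \<open>w\<close>, \<open>K w t\<close> the integral of \<open>min w x\<close> against the density,
  \<open>D\<close> the diffusion coefficient and \<open>a = D \<rho>\<close>.
  The weak form of the equation gives \<open>K\<^sub>t = - a\<close> up to a function that is affine in \<open>w\<close>. It vanishes
  because \<open>K\<close> tends to the conserved mean at infinity while \<open>a \<le> \<gamma>/2 \<rho>\<close> is integrable there. Hence
  \<open>S\<^sub>t = - a\<^sub>w\<close> as well, and no boundary condition is needed. As \<open>G = 1 - \<integral>K \<rho>\<close> and
  the kernel \<open>min\<close> is symmetric, the increment of \<open>G\<close> between \<open>s\<close> and \<open>t\<close> is the integral of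
  \<open>(K w s - K w t) (\<rho> w s + \<rho> w t)\<close>, which is nonnegative for \<open>s \<le> t\<close>.

  The derivative of \<open>G\<close> is \<open>2 \<integral>a \<rho>\<close>, by dominated convergence as soon as \<open>a\<close> is bounded
  uniformly in \<open>w\<close>, locally in time. This is parabolic smoothing: \<open>S\<close> lies in \<open>[0, 1]\<close> and solves
  \<open>S\<^sub>t = (D S\<^sub>w)\<^sub>w\<close>, so an interior gradient estimate bounds \<open>\<rho> = - S\<^sub>w\<close>, at scale \<open>w\<close>
  near \<open>0\<close>, where \<open>D\<close> is comparable to \<open>w\<^sup>2\<close>, and at scale \<open>1\<close> near infinity, where \<open>D\<close> is
  bounded above and below.
\<close>

subsection \<open>An interior gradient estimate\<close>

text \<open>\<open>f'\<close> is differentiable at \<open>x\<close> only, so the argument is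
  one-sided: with \<open>f' x = 0\<close> and \<open>l > 0\<close>, \<open>f'\<close> would be
  positive just right of \<open>x\<close>, and the mean value theorem would give a value of
  \<open>f\<close> above the maximum.\<close>

lemma second_derivative_local_max:
  fixes f :: "real \<Rightarrow> real"
  assumes "0 < d"
    and f: "\<And>y. \<bar>y - x\<bar> < d \<Longrightarrow> (f has_real_derivative f' y) (at y)"
    and f': "(f' has_real_derivative l) (at x)"
    and max: "\<And>y. \<bar>y - x\<bar> < d \<Longrightarrow> f y \<le> f x"
  shows "f' x = 0" and "l \<le> 0"
proof -
  show 0: "f' x = 0"
    using DERIV_local_max[of f "f' x" x d] f[of x] max \<open>0 < d\<close> by (auto simp: abs_minus_commute)
  show "l \<le> 0"
  proof (rule ccontr)
    assume "\<not> l \<le> 0"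
    then obtain e where e: "e > 0" "\<And>h. 0 < h \<Longrightarrow> h < e \<Longrightarrow> f' x < f' (x + h)"
      using DERIV_pos_inc_right[OF f'] by auto
    define h where "h = min e d / 2"
    have h: "0 < h" "h < e" "h < d" using e \<open>0 < d\<close> by (auto simp: h_def)
    obtain z where z: "x < z" "z < x + h" "f (x + h) - f x = (x + h - x) * f' z"
      using MVT2[of x "x + h" f f'] f h by auto
    have "f' z > 0" using e(2)[of "z - x"] z h 0 by auto
    then have "f (x + h) - f x > 0" using z h by simp
    then show False using max[of "x + h"] h by simp
  qed
qed

text \<open>Doubling of variables (Kruzhkov) for \<open>S\<^sub>t = (D S\<^sub>x)\<^sub>x\<close> with \<open>p = - S\<^sub>x\<close>: on \<open>x \<le> y \<le> x + h\<close>
  the function \<open>S x t - S y t\<close> is compared with the barrier \<open>\<Psi>\<close>. The constants \<open>M\<close>, \<open>A\<close>, \<open>B\<close>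
  are the ones for which \<open>\<Psi> \<ge> 1\<close> on the parabolic boundary away from the diagonal, and the last
  hypothesis makes \<open>\<Psi>\<close> a strict supersolution. The slope of \<open>\<Psi>\<close> on the diagonal bounds \<open>p\<close>.\<close>
lemma interior_gradient_bound:
  fixes S p q D D' :: "real \<Rightarrow> real \<Rightarrow> real"
  defines "X \<equiv> \<lambda>x0 r. {x0 - r..x0 + r}"
  assumes pos: "0 < r" "0 < \<delta>" "0 < m" "0 \<le> L" "0 < k"
    and cont: "continuous_on (X x0 r \<times> {t0 - \<delta>..t0}) (\<lambda>(x, t). S x t)"
    and osc: "\<And>x y t. x \<in> X x0 r \<Longrightarrow> y \<in> X x0 r \<Longrightarrow> t \<in> {t0 - \<delta>..t0} \<Longrightarrow> S x t - S y t \<le> 1"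
    and Sx: "\<And>x t. x \<in> X x0 r \<Longrightarrow> t \<in> {t0 - \<delta>..t0} \<Longrightarrow>
               ((\<lambda>v. S v t) has_real_derivative - p x t) (at x)"
    and px: "\<And>x t. x \<in> X x0 r \<Longrightarrow> t \<in> {t0 - \<delta>..t0} \<Longrightarrow>
               ((\<lambda>v. p v t) has_real_derivative q x t) (at x)"
    and St: "\<And>x t. x \<in> X x0 r \<Longrightarrow> t \<in> {t0 - \<delta>..t0} \<Longrightarrow>
               ((\<lambda>s. S x s) has_real_derivative - (D' x t * p x t + D x t * q x t)) (at t)"
    and p0: "\<And>x t. x \<in> X x0 r \<Longrightarrow> t \<in> {t0 - \<delta>..t0} \<Longrightarrow> 0 \<le> p x t"
    and Dm: "\<And>x t. x \<in> X x0 r \<Longrightarrow> t \<in> {t0 - \<delta>..t0} \<Longrightarrow> m \<le> D x t"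
    and D'0: "\<And>x t. x \<in> X x0 r \<Longrightarrow> t \<in> {t0 - \<delta>..t0} \<Longrightarrow> 0 \<le> D' x t"
    and D'L: "\<And>x t. x \<in> X x0 r \<Longrightarrow> t \<in> {t0 - \<delta>..t0} \<Longrightarrow> D' x t \<le> L * m"
    and k: "1 \<le> 2 * k * r" "1 < \<delta> * m * (16 * k\<^sup>2 - 4 / r\<^sup>2 - 4 * L * k - 2 * L / r)"
  shows "p x0 t0 \<le> 4 * k"
proof -
  define M where "M = 4 * k"
  \<comment> \<open>\<open>h\<close> is the vertex of the parabola \<open>s - k s^2\<close>, whose
    value there is \<open>1 / (4 * k) = 1 / M\<close>; hence the first term of the barrier equals 1
    at \<open>y = x + h\<close>.\<close>
  define h where "h = 1 / (2 * k)"
  define A where "A = 1 / r\<^sup>2"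
  define B where "B = 1 / \<delta>"
  have h: "0 < h" "h \<le> r" "M * (h - k * h\<^sup>2) = 1"
    using pos k by (auto simp: h_def M_def field_simps power2_eq_square)
  have AB: "0 < A" "0 < B" "A * r\<^sup>2 = 1" "B * \<delta> = 1" using pos by (auto simp: A_def B_def)
  define \<Psi> where "\<Psi> = (\<lambda>x y t. M * ((y - x) - k * (y - x)\<^sup>2) + A * ((x - x0)\<^sup>2 + (y - x0)\<^sup>2) + B * (t0 - t))"
  have \<Psi>1: "0 \<le> M * (s - k * s\<^sup>2)" if "0 \<le> s" "s \<le> h" for s
  proof -
    have "k * s \<le> 1/2" using that pos by (simp add: h_def field_simps)
    then have "0 \<le> s * (1 - k * s)" using that by simp
    then show ?thesis using pos by (simp add: M_def algebra_simps power2_eq_square)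
  qed
  define F where "F = (\<lambda>(x, y, t). S x t - S y t - \<Psi> x y t)"
  define \<Omega> where "\<Omega> = {z \<in> X x0 r \<times> X x0 r \<times> {t0 - \<delta>..t0}. fst z \<le> fst (snd z) \<and> fst (snd z) \<le> fst z + h}"
  have "\<Omega> = (X x0 r \<times> X x0 r \<times> {t0 - \<delta>..t0}) \<inter>
      ({z. fst z \<le> fst (snd z)} \<inter> {z. fst (snd z) \<le> fst z + h})" by (auto simp: \<Omega>_def)
  also have "compact \<dots>"
    unfolding X_def
    by (intro compact_Int_closed compact_Times compact_Icc closed_Int closed_Collect_le continuous_intros)
  finally have "compact \<Omega>" .
  moreover have "(x0, x0, t0) \<in> \<Omega>" using pos h by (auto simp: \<Omega>_def X_def)
  moreover have "continuous_on \<Omega> F"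
  proof -
    have 1: "continuous_on \<Omega> (\<lambda>z. S (fst z) (snd (snd z)))"
    proof -
      have "continuous_on \<Omega> (\<lambda>z. (\<lambda>(x, t). S x t) (fst z, snd (snd z)))"
        by (rule continuous_on_compose2[OF cont]) (auto simp: \<Omega>_def intro!: continuous_intros)
      then show ?thesis by (simp add: split_beta)
    qed
    have 2: "continuous_on \<Omega> (\<lambda>z. S (fst (snd z)) (snd (snd z)))"
    proof -
      have "continuous_on \<Omega> (\<lambda>z. (\<lambda>(x, t). S x t) (fst (snd z), snd (snd z)))"
        by (rule continuous_on_compose2[OF cont]) (auto simp: \<Omega>_def intro!: continuous_intros)
      then show ?thesis by (simp add: split_beta)
    qed
    show ?thesis unfolding F_def \<Psi>_def split_beta
      by (intro continuous_intros 1 2)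
  qed
  ultimately obtain z where z: "z \<in> \<Omega>" "\<And>z'. z' \<in> \<Omega> \<Longrightarrow> F z' \<le> F z"
    using continuous_attains_sup[of \<Omega> F] by blast
  obtain x y t where xyt: "z = (x, y, t)" by (cases z)
  have in\<Omega>: "x \<in> X x0 r" "y \<in> X x0 r" "t \<in> {t0 - \<delta>..t0}" "x \<le> y" "y \<le> x + h"
    using z(1) by (auto simp: \<Omega>_def xyt)
  \<comment> \<open>At a point with \<open>F z > 0\<close> the barrier is below the oscillation
    bound 1. This excludes \<open>y = x + h\<close>, the outer ends of both space intervals and the
    initial time, while \<open>F \<le> 0\<close> on the diagonal. The derivative tests at
    \<open>z\<close> then contradict the choice of \<open>k\<close>.\<close>
  have "F z \<le> 0"
  proof (rule ccontr)
    assume "\<not> F z \<le> 0"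
    then have F0: "\<Psi> x y t < S x t - S y t" by (simp add: F_def xyt)
    have S1: "S x t - S y t \<le> 1" using osc in\<Omega> by auto
    have Mnn: "0 \<le> M * ((y - x) - k * (y - x)\<^sup>2)" using \<Psi>1[of "y - x"] in\<Omega> by auto
    have Bnn: "0 \<le> B * (t0 - t)" using in\<Omega> AB by auto
    have Ax: "0 \<le> A * (x - x0)\<^sup>2" "0 \<le> A * (y - x0)\<^sup>2" using AB by auto
    have dec: "\<Psi> x y t = M * ((y - x) - k * (y - x)\<^sup>2) + A * (x - x0)\<^sup>2 + A * (y - x0)\<^sup>2 + B * (t0 - t)"
      by (simp add: \<Psi>_def algebra_simps)
    have lt1: "\<Psi> x y t < 1" using F0 S1 by simp
    have "x \<noteq> y"
      using F0 dec Mnn Bnn Ax by auto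
    have "y \<noteq> x + h"
    proof
      assume "y = x + h"
      then have "M * ((y - x) - k * (y - x)\<^sup>2) = 1" using h(3) by simp
      then show False using lt1 dec Mnn Bnn Ax by linarith
    qed
    have "x \<noteq> x0 - r"
    proof
      assume "x = x0 - r"
      then have "A * (x - x0)\<^sup>2 = 1" using AB by simp
      then show False using lt1 dec Mnn Bnn Ax by linarith
    qed
    have "y \<noteq> x0 + r"
    proof
      assume "y = x0 + r"
      then have "A * (y - x0)\<^sup>2 = 1" using AB by simp
      then show False using lt1 dec Mnn Bnn Ax by linarith
    qed
    have "t \<noteq> t0 - \<delta>"
    proof
      assume "t = t0 - \<delta>"
      then have "B * (t0 - t) = 1" using AB by simp
      then show False using lt1 dec Mnn Bnn Ax by linarith
    qed
    have str: "x < y" "y < x + h" "x0 - r < x" "y < x0 + r" "t0 - \<delta> < t"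
      using in\<Omega> \<open>x \<noteq> y\<close> \<open>y \<noteq> x + h\<close> \<open>x \<noteq> x0 - r\<close> \<open>y \<noteq> x0 + r\<close> \<open>t \<noteq> t0 - \<delta>\<close> by (auto simp: X_def)
    \<comment> \<open>Moving \<open>x\<close> or \<open>y\<close> by less than \<open>d\<close>, or
      going back in time by less than \<open>d\<close>, stays in the domain. Later times are not
      covered, since \<open>t = t0\<close> is possible.\<close>
    define d where "d = Min {y - x, x + h - y, x - (x0 - r), x0 + r - y, t - (t0 - \<delta>)}"
    have d: "d > 0" "d \<le> y - x" "d \<le> x + h - y" "d \<le> x - (x0 - r)" "d \<le> x0 + r - y" "d \<le> t - (t0 - \<delta>)"
      using str by (auto simp: d_def)
    have inx: "v \<in> X x0 r \<and> (v, y, t) \<in> \<Omega>" if "\<bar>v - x\<bar> < d" for v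
      using that d in\<Omega> str by (auto simp: \<Omega>_def X_def)
    have iny: "v \<in> X x0 r \<and> (x, v, t) \<in> \<Omega>" if "\<bar>v - y\<bar> < d" for v
      using that d in\<Omega> str by (auto simp: \<Omega>_def X_def)
    define s where "s = y - x"
    \<comment> \<open>\<open>x\<close> and \<open>y\<close> are varied one at a time. The
      first-order condition gives \<open>p\<close>, the second-order one a one-sided bound on
      \<open>q\<close>; below, the same is done at \<open>y\<close>.\<close>
    have X: "- p x t - (- M * (1 - 2 * k * s) + 2 * A * (x - x0)) = 0" "- q x t - (2 * A - 2 * M * k) \<le> 0"
    proof -
      let ?f = "\<lambda>v. F (v, y, t)" and ?f' = "\<lambda>v. - p v t - (- M * (1 - 2 * k * (y - v)) + 2 * A * (v - x0))"
      have 1: "(?f has_real_derivative ?f' v) (at v)" if "\<bar>v - x\<bar> < d" for v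
        unfolding F_def \<Psi>_def split
        by (rule derivative_eq_intros Sx inx[THEN conjunct1] that in\<Omega> refl | simp)+
           (simp add: algebra_simps)
      have 2: "(?f' has_real_derivative (- q x t - (2 * A - 2 * M * k))) (at x)"
        by (rule derivative_eq_intros px in\<Omega> refl | simp)+
      have 3: "?f v \<le> ?f x" if "\<bar>v - x\<bar> < d" for v
        using z(2) inx[OF that] by (simp add: xyt)
      show "- p x t - (- M * (1 - 2 * k * s) + 2 * A * (x - x0)) = 0" "- q x t - (2 * A - 2 * M * k) \<le> 0"
        using second_derivative_local_max[OF d(1) 1 2 3] by (auto simp: s_def)
    qed
    have Y: "p y t - (M * (1 - 2 * k * s) + 2 * A * (y - x0)) = 0" "q y t - (2 * A - 2 * M * k) \<le> 0"
    proof -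
      let ?f = "\<lambda>v. F (x, v, t)" and ?f' = "\<lambda>v. p v t - (M * (1 - 2 * k * (v - x)) + 2 * A * (v - x0))"
      have 1: "(?f has_real_derivative ?f' v) (at v)" if "\<bar>v - y\<bar> < d" for v
        unfolding F_def \<Psi>_def split
        by (rule derivative_eq_intros Sx iny[THEN conjunct1] that in\<Omega> refl | simp)+
           (simp add: algebra_simps)
      have 2: "(?f' has_real_derivative (q y t - (2 * A - 2 * M * k))) (at y)"
        by (rule derivative_eq_intros px in\<Omega> refl | simp)+
      have 3: "?f v \<le> ?f y" if "\<bar>v - y\<bar> < d" for v
        using z(2) iny[OF that] by (simp add: xyt)
      show "p y t - (M * (1 - 2 * k * s) + 2 * A * (y - x0)) = 0" "q y t - (2 * A - 2 * M * k) \<le> 0"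
        using second_derivative_local_max[OF d(1) 1 2 3] by (auto simp: s_def)
    qed
    define l where "l = - (D' x t * p x t + D x t * q x t) + (D' y t * p y t + D y t * q y t) + B"
    \<comment> \<open>\<open>l\<close> is the time derivative of \<open>F\<close> at the maximum. If
      it were negative, slightly earlier times would give larger values; comparison with the past
      alone also covers \<open>t = t0\<close>.\<close>
    have "l \<ge> 0"
    proof (rule ccontr)
      assume "\<not> l \<ge> 0"
      have "((\<lambda>v. F (x, y, v)) has_real_derivative l) (at t)"
        unfolding F_def \<Psi>_def split l_def
        by (rule derivative_eq_intros St in\<Omega> refl | simp)+
      then obtain e where e: "e > 0" "\<And>h. 0 < h \<Longrightarrow> h < e \<Longrightarrow> F (x, y, t - h) > F (x, y, t)"
        using DERIV_neg_dec_left[of "\<lambda>v. F (x, y, v)" l t] \<open>\<not> l \<ge> 0\<close> by auto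
      define c where "c = min e d / 2"
      have c: "0 < c" "c < e" "c < d" using e d by (auto simp: c_def)
      have "(x, y, t - c) \<in> \<Omega>" using c d in\<Omega> by (auto simp: \<Omega>_def)
      from z(2)[OF this] e(2)[OF c(1,2)] show False by (simp add: xyt)
    qed
    have Ar: "A * (y - x0) \<le> A * r" using AB in\<Omega> by (auto simp: X_def)
    have "M * (1 - 2 * k * s) \<le> M" using pos str by (simp add: M_def s_def)
    then have py: "p y t \<le> M + 2 * A * r" using Y(1) Ar by linarith
    \<comment> \<open>By \<open>1 \<le> 2 * k * r\<close> the barrier's second-derivative bound is
      nonpositive, so multiplying it by \<open>D\<close> is at worst multiplying it by the lower
      bound \<open>m\<close>.\<close>
    have Mk: "2 * A - 2 * M * k \<le> 0"
    proof -
      have "1 \<le> (2 * k * r)\<^sup>2" using k(1) by (simp add: one_le_power)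
      then have "1 / r\<^sup>2 \<le> 4 * k\<^sup>2" using pos by (simp add: field_simps power2_eq_square)
      moreover have "0 \<le> k\<^sup>2" by simp
      ultimately have "A \<le> 4 * k\<^sup>2" by (simp add: A_def)
      then show ?thesis by (simp add: M_def power2_eq_square)
    qed
    have Dx: "- (D x t * q x t) \<le> m * (2 * A - 2 * M * k)"
    proof -
      have "D x t * - q x t \<le> D x t * (2 * A - 2 * M * k)"
        using X(2) Dm[OF in\<Omega>(1,3)] pos by (intro mult_left_mono) auto
      also have "\<dots> \<le> m * (2 * A - 2 * M * k)"
        using Dm[OF in\<Omega>(1,3)] Mk by (intro mult_right_mono_neg) auto
      finally show ?thesis by simp
    qed
    have Dy: "D y t * q y t \<le> m * (2 * A - 2 * M * k)"
    proof -
      have "D y t * q y t \<le> D y t * (2 * A - 2 * M * k)"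
        using Y(2) Dm[OF in\<Omega>(2,3)] pos by (intro mult_left_mono) auto
      also have "\<dots> \<le> m * (2 * A - 2 * M * k)"
        using Dm[OF in\<Omega>(2,3)] Mk by (intro mult_right_mono_neg) auto
      finally show ?thesis by simp
    qed
    \<comment> \<open>Of the two first-order terms in \<open>l\<close>, the one at \<open>x\<close>
      has the favourable sign and is dropped; the one at \<open>y\<close> is controlled by
      \<open>py\<close>, that is by the first-order condition at \<open>y\<close>.\<close>
    have "D' y t * p y t \<le> (L * m) * (M + 2 * A * r)"
      using D'L[OF in\<Omega>(2,3)] py p0[OF in\<Omega>(2,3)] pos by (intro mult_mono) auto
    moreover have "0 \<le> D' x t * p x t" using D'0 p0 in\<Omega> by auto
    ultimately have "l \<le> (L * m) * (M + 2 * A * r) + 2 * (m * (2 * A - 2 * M * k)) + B"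
      using Dx Dy unfolding l_def by linarith
    also have "\<dots> = B - m * (16 * k\<^sup>2 - 4 / r\<^sup>2 - 4 * L * k - 2 * L / r)"
      using pos by (simp add: A_def M_def field_simps power2_eq_square)
    also have "\<dots> < 0"
      using k(2) pos by (simp add: B_def field_simps)
    finally show False using \<open>l \<ge> 0\<close> by simp
  qed
  then have F0: "F z' \<le> 0" if "z' \<in> \<Omega>" for z' using z(2)[OF that] by simp
  \<comment> \<open>\<open>F\<close> vanishes at the diagonal point \<open>(x0, x0, t0)\<close> and
    is nonpositive for \<open>y\<close> slightly larger, so its slope \<open>p x0 t0 - M\<close> in
    \<open>y\<close> cannot be positive.\<close>
  let ?f = "\<lambda>v. F (x0, v, t0)"
  have x0: "x0 \<in> X x0 r" "t0 \<in> {t0 - \<delta>..t0}" using pos by (auto simp: X_def)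
  have 1: "(?f has_real_derivative p x0 t0 - M) (at x0)"
    unfolding F_def \<Psi>_def split
    by (rule derivative_eq_intros Sx x0 refl | simp)+
  show ?thesis
  proof (rule ccontr)
    assume "\<not> p x0 t0 \<le> 4 * k"
    then obtain e where e: "e > 0" "\<And>h. 0 < h \<Longrightarrow> h < e \<Longrightarrow> ?f x0 < ?f (x0 + h)"
      using DERIV_pos_inc_right[OF 1] by (auto simp: M_def)
    define c where "c = min e h / 2"
    have c: "0 < c" "c < e" "c < h" using e h by (auto simp: c_def)
    have "(x0, x0 + c, t0) \<in> \<Omega>" using c h pos by (auto simp: \<Omega>_def X_def)
    from F0[OF this] e(2)[OF c(1,2)] show False by (simp add: F_def \<Psi>_def)
  qed
qed

subsection \<open>Integrals against a varying density\<close>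

text \<open>Split \<open>g n * P n\<close> into \<open>g n * (P n - p)\<close> and
  \<open>g n * p\<close>. The first part vanishes by L1 convergence and the uniform bound on
  \<open>g n\<close>; only the second needs dominated convergence, with the fixed majorant
  \<open>C * \<bar>p\<bar>\<close>.\<close>

lemma tendsto_integral_mult:
  fixes g :: "nat \<Rightarrow> 'a \<Rightarrow> real"
  assumes p: "integrable M p" and P: "\<And>n. integrable M (P n)"
    and lim: "(\<lambda>n. \<integral>x. \<bar>P n x - p x\<bar> \<partial>M) \<longlonglongrightarrow> 0"
    and [measurable]: "\<And>n. g n \<in> borel_measurable M" "h \<in> borel_measurable M"
    and bound: "\<And>n x. \<bar>g n x\<bar> \<le> C"
    and g: "AE x in M. (\<lambda>n. g n x) \<longlonglongrightarrow> h x"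
  shows "(\<lambda>n. \<integral>x. g n x * P n x \<partial>M) \<longlonglongrightarrow> (\<integral>x. h x * p x \<partial>M)"
proof -
  have [measurable]: "p \<in> borel_measurable M" "\<And>n. P n \<in> borel_measurable M"
    using p P by auto
  have C: "0 \<le> C" using bound[of 0 undefined] by linarith
  have i1: "integrable M (\<lambda>x. g n x * (P n x - p x))" for n
    by (rule Bochner_Integration.integrable_bound[of _ "\<lambda>x. C * \<bar>P n x - p x\<bar>"])
       (use p P bound in \<open>auto intro!: mult_right_mono simp: abs_mult C\<close>)
  have i2: "integrable M (\<lambda>x. g n x * p x)" for n
    by (rule Bochner_Integration.integrable_bound[of _ "\<lambda>x. C * \<bar>p x\<bar>"])
       (use p P bound in \<open>auto intro!: mult_right_mono simp: abs_mult C\<close>)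
  have "(\<lambda>n. \<integral>x. g n x * (P n x - p x) \<partial>M) \<longlonglongrightarrow> 0"
  proof (rule Lim_null_comparison)
    show "\<forall>\<^sub>F n in sequentially. norm (\<integral>x. g n x * (P n x - p x) \<partial>M) \<le> C * (\<integral>x. \<bar>P n x - p x\<bar> \<partial>M)"
    proof (intro always_eventually allI)
      fix n
      have "norm (\<integral>x. g n x * (P n x - p x) \<partial>M) \<le> (\<integral>x. norm (g n x * (P n x - p x)) \<partial>M)"
        by (rule integral_norm_bound)
      also have "\<dots> \<le> (\<integral>x. C * \<bar>P n x - p x\<bar> \<partial>M)"
        by (intro integral_mono integrable_norm i1)
           (use p P bound in \<open>auto intro!: mult_right_mono simp: abs_mult\<close>)
      finally show "norm (\<integral>x. g n x * (P n x - p x) \<partial>M) \<le> C * (\<integral>x. \<bar>P n x - p x\<bar> \<partial>M)"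
        by simp
    qed
    show "(\<lambda>n. C * (\<integral>x. \<bar>P n x - p x\<bar> \<partial>M)) \<longlonglongrightarrow> 0"
      using tendsto_mult[OF tendsto_const lim, of C] by simp
  qed
  moreover have "(\<lambda>n. \<integral>x. g n x * p x \<partial>M) \<longlonglongrightarrow> (\<integral>x. h x * p x \<partial>M)"
  proof (rule integral_dominated_convergence[where w="\<lambda>x. C * \<bar>p x\<bar>"])
    show "AE x in M. (\<lambda>n. g n x * p x) \<longlonglongrightarrow> h x * p x"
      using g by eventually_elim (intro tendsto_intros)
    show "AE x in M. norm (g n x * p x) \<le> C * \<bar>p x\<bar>" for n
      using bound by (auto intro!: mult_right_mono simp: abs_mult)
  qed (use p in auto)
  ultimately have "(\<lambda>n. (\<integral>x. g n x * (P n x - p x) \<partial>M) + (\<integral>x. g n x * p x \<partial>M)) \<longlonglongrightarrow>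
      0 + (\<integral>x. h x * p x \<partial>M)" by (rule tendsto_add)
  moreover have "(\<integral>x. g n x * (P n x - p x) \<partial>M) + (\<integral>x. g n x * p x \<partial>M) = (\<integral>x. g n x * P n x \<partial>M)" for n
    by (subst Bochner_Integration.integral_add[OF i1 i2, symmetric]) (simp add: algebra_simps)
  ultimately show ?thesis by simp
qed

lemma integral_Icc_eq_lborel:
  fixes f :: "real \<Rightarrow> real"
  assumes "continuous_on {b..c} f"
  shows "integrable lborel (\<lambda>x. indicator {b..c} x * f x)"
    and "(\<integral>x. indicator {b..c} x * f x \<partial>lborel) = integral {b..c} f"
proof -
  have *: "set_integrable lborel {b..c} f"
    by (rule borel_integrable_compact[OF compact_Icc assms, folded set_integrable_def])
  then show "integrable lborel (\<lambda>x. indicator {b..c} x * f x)"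
    by (simp add: set_integrable_def)
  show "(\<integral>x. indicator {b..c} x * f x \<partial>lborel) = integral {b..c} f"
    using set_borel_integral_eq_integral(2)[OF *] by (simp add: set_lebesgue_integral_def)
qed

text \<open>Near \<open>w\<close> the tail from \<open>v\<close> is the fixed tail from
  \<open>w/2\<close> minus the integral over \<open>{w/2..v}\<close>, to which the fundamental
  theorem of calculus applies.\<close>

lemma tail_integral_has_derivative:
  fixes f :: "real \<Rightarrow> real"
  assumes cont: "continuous_on {0<..} f"
    and int: "integrable lborel (\<lambda>x. indicator {0<..} x * f x)" and "0 < w"
  shows "((\<lambda>v. \<integral>x. indicator {v<..} x * f x \<partial>lborel) has_real_derivative - f w) (at w)"
proof -
  have c: "continuous_on {w/2..2*w} f"
    by (rule continuous_on_subset[OF cont]) (use \<open>0 < w\<close> in auto)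
  have tail: "integrable lborel (\<lambda>x. indicator A x * f x)" if "A \<subseteq> {0<..}" "A \<in> sets borel" for A
  proof -
    have "integrable lborel (\<lambda>x. indicator A x *\<^sub>R (indicator {0<..} x * f x))"
      using that by (intro integrable_mult_indicator int) auto
    moreover have "(\<lambda>x. indicator A x *\<^sub>R (indicator {0<..} x * f x)) = (\<lambda>x. indicator A x * f x)"
      using that by (auto simp: indicator_def fun_eq_iff)
    ultimately show ?thesis by simp
  qed
  have "((\<lambda>v. (\<integral>x. indicator {w/2..} x * f x \<partial>lborel) - integral {w/2..v} f) has_real_derivative - f w)
      (at w within {w/2..2*w})"
    by (rule derivative_eq_intros integral_has_real_derivative[OF c] refl | use \<open>0 < w\<close> in simp)+
  moreover have "at w within {w/2..2*w} = at w" using \<open>0 < w\<close> by (intro at_within_Icc_at) auto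
  ultimately have "((\<lambda>v. (\<integral>x. indicator {w/2..} x * f x \<partial>lborel) - integral {w/2..v} f) has_real_derivative - f w) (at w)"
    by simp
  then show ?thesis
  proof (rule has_field_derivative_transform_within_open[where S="{w/2<..<2*w}"])
    fix v assume v: "v \<in> {w/2<..<2*w}"
    have cv: "continuous_on {w/2..v} f"
      by (rule continuous_on_subset[OF cont]) (use v \<open>0 < w\<close> in auto)
    have "(\<integral>x. indicator {w/2..} x * f x \<partial>lborel) =
        (\<integral>x. indicator {w/2..v} x * f x + indicator {v<..} x * f x \<partial>lborel)"
      by (intro Bochner_Integration.integral_cong) (use v in \<open>auto simp: indicator_def\<close>)
    also have "\<dots> = integral {w/2..v} f + (\<integral>x. indicator {v<..} x * f x \<partial>lborel)"
      using v \<open>0 < w\<close>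
      by (subst Bochner_Integration.integral_add)
         (auto intro!: tail integral_Icc_eq_lborel cv)
    finally show "(\<integral>x. indicator {w/2..} x * f x \<partial>lborel) - integral {w/2..v} f =
        (\<integral>x. indicator {v<..} x * f x \<partial>lborel)" by simp
  qed (use \<open>0 < w\<close> in auto)
qed

subsection \<open>The solution at a fixed time\<close>

text \<open>The one-variable profile of the kernel: \<open>kappa w x\<close> is its value at
  \<open>min w x\<close>. It is continuous and increasing on the half-line, with a slope jump at
  1.\<close>

definition kap :: "real \<Rightarrow> real" where
  "kap w = (if w < 1 then w\<^sup>2 else w)"

lemma kap_min: "kappa w x = kap (min w x)"
  by (simp add: kappa_def kap_def)

lemma kap_bounds: "0 < w \<Longrightarrow> 0 < kap w" "0 \<le> w \<Longrightarrow> kap w \<le> w"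
  by (auto simp: kap_def power2_eq_square mult_left_le)

lemma kap_mono: "0 \<le> v \<Longrightarrow> v \<le> w \<Longrightarrow> kap v \<le> kap w"
proof -
  assume vw: "0 \<le> v" "v \<le> w"
  have "v\<^sup>2 \<le> v" if "v < 1" using that vw by (simp add: power2_eq_square mult_left_le)
  then show ?thesis using vw by (auto simp: kap_def intro: power_mono)
qed

lemma abs_kap_min_le:
  assumes "0 < w" "0 < x"
  shows "\<bar>kap (min w x)\<bar> \<le> w" "\<bar>kap (min w x)\<bar> \<le> x"
  using kap_bounds[of "min w x"] assms by simp_all

lemma continuous_kap: "continuous_on UNIV kap"
proof -
  have "continuous_on ({..1} \<union> {1..}) (\<lambda>w::real. if w \<le> 1 then w\<^sup>2 else w)"
    by (rule continuous_on_If) (auto intro!: continuous_intros)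
  moreover have "(\<lambda>w::real. if w \<le> 1 then w\<^sup>2 else w) = kap"
    by (auto simp: kap_def fun_eq_iff)
  moreover have "{..1} \<union> {1..} = (UNIV :: real set)" by auto
  ultimately show ?thesis by metis
qed

lemma borel_measurable_kap [measurable]: "kap \<in> borel_measurable borel"
  by (rule borel_measurable_continuous_onI[OF continuous_kap])

lemma kap_has_derivative:
  assumes "w \<noteq> 1"
  shows "(kap has_real_derivative (if w < 1 then 2 * w else 1)) (at w)"
proof (cases "w < 1")
  case True
  have "((\<lambda>w. w\<^sup>2) has_real_derivative 2 * w) (at w)"
    by (auto intro!: derivative_eq_intros)
  then have "(kap has_real_derivative 2 * w) (at w)"
    by (rule has_field_derivative_transform_within_open[where S="{..<1}"]) (use True in \<open>auto simp: kap_def\<close>)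
  then show ?thesis using True by simp
next
  case False
  have "((\<lambda>w. w) has_real_derivative 1) (at w)"
    by (auto intro!: derivative_eq_intros)
  then have "(kap has_real_derivative 1) (at w)"
    by (rule has_field_derivative_transform_within_open[where S="{1<..}"]) (use False assms in \<open>auto simp: kap_def\<close>)
  then show ?thesis using False by simp
qed

text \<open>The existential witnesses of \<open>modified_ysm_solution\<close> become parameters, so
  that the flux derivative \<open>J\<close> can be named throughout.\<close>

locale ysm_solution =
  fixes \<gamma> :: real and T :: "real set" and \<rho> \<rho>t J :: "real \<Rightarrow> real \<Rightarrow> real"
  assumes gamma_pos: "0 < \<gamma>"
    and interval: "is_interval T"
    and density: "\<And>t. t \<in> T \<Longrightarrow> wealth_density (\<lambda>w. \<rho> w t)"
    and cont: "continuous_on ({0<..} \<times> T) (\<lambda>(w, t). \<rho> w t)"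
    and cont_rt: "continuous_on ({0<..} \<times> interior T) (\<lambda>(w, t). \<rho>t w t)"
    and deriv_t: "\<And>w t. 0 < w \<Longrightarrow> t \<in> interior T \<Longrightarrow>
       ((\<lambda>s. \<rho> w s) has_real_derivative \<rho>t w t) (at t)"
    and deriv_flux: "\<And>w t. 0 < w \<Longrightarrow> t \<in> interior T \<Longrightarrow>
       ((\<lambda>v. diffusion \<gamma> (\<lambda>x. \<rho> x t) v * \<rho> v t) has_real_derivative J w t) (at w)"
    and deriv_J: "\<And>w t. 0 < w \<Longrightarrow> t \<in> interior T \<Longrightarrow>
       ((\<lambda>v. J v t) has_real_derivative \<rho>t w t) (at w)"
begin

text \<open>Extension of the density by zero, which turns integrals over the half-line into
  integrals over the whole line; \<rho> itself is uncontrolled at nonpositive wealth.\<close>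

definition p :: "real \<Rightarrow> real \<Rightarrow> real" where
  "p t x = indicator {0<..} x * \<rho> x t"

definition S :: "real \<Rightarrow> real \<Rightarrow> real" where
  "S w t = (\<integral>x. indicator {w<..} x * p t x \<partial>lborel)"

definition K :: "real \<Rightarrow> real \<Rightarrow> real" where
  "K w t = (\<integral>x. min w x * p t x \<partial>lborel)"

definition D :: "real \<Rightarrow> real \<Rightarrow> real" where
  "D w t = diffusion \<gamma> (\<lambda>x. \<rho> x t) w"

definition a :: "real \<Rightarrow> real \<Rightarrow> real" where
  "a w t = D w t * \<rho> w t"

section \<open>Moments and integrability of the density\<close>

lemma p_facts:
  assumes "t \<in> T"
  shows p_nonneg: "0 \<le> p t x"
    and p_zero: "x \<le> 0 \<Longrightarrow> p t x = 0"
    and integrable_p: "integrable lborel (p t)"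
    and integral_p: "(\<integral>x. p t x \<partial>lborel) = 1"
    and integrable_xp: "integrable lborel (\<lambda>x. x * p t x)"
    and integral_xp: "(\<integral>x. x * p t x \<partial>lborel) = 1"
proof -
  have 1: "(\<lambda>w. indicator {0<..} w *\<^sub>R \<rho> w t) = p t" by (simp add: p_def fun_eq_iff)
  have 2: "(\<lambda>w. indicator {0<..} w *\<^sub>R (w * \<rho> w t)) = (\<lambda>x. x * p t x)" by (simp add: p_def fun_eq_iff)
  note d = density[OF assms, unfolded wealth_density_def set_integrable_def set_lebesgue_integral_def 1 2]
  show "0 \<le> p t x" "x \<le> 0 \<Longrightarrow> p t x = 0"
    using d by (auto simp: p_def indicator_def)
  show "integrable lborel (p t)" "(\<integral>x. p t x \<partial>lborel) = 1"
    "integrable lborel (\<lambda>x. x * p t x)" "(\<integral>x. x * p t x \<partial>lborel) = 1"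
    using d by auto
qed

lemma rho_nonneg: "t \<in> T \<Longrightarrow> 0 < w \<Longrightarrow> 0 \<le> \<rho> w t"
  using density by (auto simp: wealth_density_def)

lemma p_measurable: "t \<in> T \<Longrightarrow> p t \<in> borel_measurable borel"
  using integrable_p[of t] by auto

lemma integrable_mult_p:
  assumes "t \<in> T" and [measurable]: "g \<in> borel_measurable borel"
    and "\<And>x. 0 < x \<Longrightarrow> \<bar>g x\<bar> \<le> C * x + C'"
  shows "integrable lborel (\<lambda>x. g x * p t x)"
proof (rule Bochner_Integration.integrable_bound[of _ "\<lambda>x. C * (x * p t x) + C' * p t x"])
  note [measurable] = p_measurable[OF \<open>t \<in> T\<close>]
  show "integrable lborel (\<lambda>x. C * (x * p t x) + C' * p t x)"
    using assms by (intro Bochner_Integration.integrable_add integrable_mult_right integrable_p integrable_xp)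
  show "(\<lambda>x. g x * p t x) \<in> borel_measurable lborel" by measurable
  have "norm (g x * p t x) \<le> norm (C * (x * p t x) + C' * p t x)" for x
  proof (cases "0 < x")
    case True
    have "\<bar>g x\<bar> * p t x \<le> (C * x + C') * p t x"
      using assms True by (intro mult_right_mono p_nonneg) auto
    then show ?thesis using p_nonneg[OF assms(1), of x]
      by (simp add: abs_mult algebra_simps)
  qed (use assms p_zero in auto)
  then show "AE x in lborel. norm (g x * p t x) \<le> norm (C * (x * p t x) + C' * p t x)" by simp
qed

section \<open>Convergence and joint continuity in wealth and time\<close>

lemma tendsto_rho:
  assumes "\<And>n. u n \<in> T" "l \<in> T" "u \<longlonglongrightarrow> l" "\<And>n. 0 < v n" "0 < w" "v \<longlonglongrightarrow> w"
  shows "(\<lambda>n. \<rho> (v n) (u n)) \<longlonglongrightarrow> \<rho> w l"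
proof -
  have "(\<lambda>n. (v n, u n)) \<longlonglongrightarrow> (w, l)" using assms by (intro tendsto_Pair)
  then have "((\<lambda>(w, t). \<rho> w t) \<circ> (\<lambda>n. (v n, u n))) \<longlonglongrightarrow> (\<lambda>(w, t). \<rho> w t) (w, l)"
    using cont[unfolded continuous_on_sequentially, rule_format, of "(w, l)" "\<lambda>n. (v n, u n)"] assms by auto
  then show ?thesis by (simp add: o_def)
qed

text \<open>Scheffe's lemma: the densities converge pointwise and all have mass 1, so they converge
  in L1. Conservation of mass replaces a majorant uniform in time.\<close>

lemma tendsto_p_L1:
  assumes "\<And>n. u n \<in> T" "l \<in> T" "u \<longlonglongrightarrow> l"
  shows "(\<lambda>n. \<integral>x. \<bar>p (u n) x - p l x\<bar> \<partial>lborel) \<longlonglongrightarrow> 0"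
proof -
  note [measurable] = p_measurable[OF assms(1)] p_measurable[OF assms(2)]
  have one: "(\<integral>\<^sup>+x. norm (p t x) \<partial>lborel) = 1" if "t \<in> T" for t
  proof -
    have "(\<integral>\<^sup>+x. norm (p t x) \<partial>lborel) = (\<integral>\<^sup>+x. p t x \<partial>lborel)"
      using p_nonneg[OF that] by simp
    also have "\<dots> = ennreal (\<integral>x. p t x \<partial>lborel)"
      by (rule nn_integral_eq_integral) (use integrable_p[OF that] p_nonneg[OF that] in auto)
    finally show ?thesis using integral_p[OF that] by simp
  qed
  have "(\<lambda>n. \<integral>\<^sup>+x. norm (p (u n) x - p l x) \<partial>lborel) \<longlonglongrightarrow> 0"
  proof (rule Scheffe_lemma2)
    show "AE x in lborel. (\<lambda>n. p (u n) x) \<longlonglongrightarrow> p l x"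
    proof (intro AE_I2)
      fix x :: real
      show "(\<lambda>n. p (u n) x) \<longlonglongrightarrow> p l x"
      proof (cases "0 < x")
        case True
        then show ?thesis using tendsto_rho[OF assms, of "\<lambda>_. x" x] by (simp add: p_def)
      qed (simp add: p_def)
    qed
  qed (use one assms integrable_p in auto)
  moreover have "(\<integral>\<^sup>+x. norm (p (u n) x - p l x) \<partial>lborel) = ennreal (\<integral>x. \<bar>p (u n) x - p l x\<bar> \<partial>lborel)" for n
    by (subst nn_integral_eq_integral) (use integrable_p assms in auto)
  ultimately have "(\<lambda>n. ennreal (\<integral>x. \<bar>p (u n) x - p l x\<bar> \<partial>lborel)) \<longlonglongrightarrow> ennreal 0" by simp
  then show ?thesis by (subst (asm) tendsto_ennreal_iff) auto
qed

lemma tendsto_integral_p: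
  fixes g :: "nat \<Rightarrow> real \<Rightarrow> real"
  assumes u: "\<And>n. u n \<in> T" "l \<in> T" "u \<longlonglongrightarrow> l"
    and [measurable]: "\<And>n. g n \<in> borel_measurable borel" "h \<in> borel_measurable borel"
    and bound: "\<And>n x. 0 < x \<Longrightarrow> \<bar>g n x\<bar> \<le> C"
    and g: "AE x in lborel. 0 < x \<longrightarrow> (\<lambda>n. g n x) \<longlonglongrightarrow> h x"
  shows "(\<lambda>n. \<integral>x. g n x * p (u n) x \<partial>lborel) \<longlonglongrightarrow> (\<integral>x. h x * p l x \<partial>lborel)"
proof -
  have "(\<lambda>n. \<integral>x. (indicator {0<..} x * g n x) * p (u n) x \<partial>lborel) \<longlonglongrightarrow>
      (\<integral>x. (indicator {0<..} x * h x) * p l x \<partial>lborel)"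
  proof (rule tendsto_integral_mult[where C="\<bar>C\<bar>"])
    show "\<bar>indicator {0<..} x * g n x\<bar> \<le> \<bar>C\<bar>" for n x
      using bound[of x n] by (auto simp: indicator_def)
    show "AE x in lborel. (\<lambda>n. indicator {0<..} x * g n x) \<longlonglongrightarrow> indicator {0<..} x * h x"
      using g by eventually_elim (auto simp: indicator_def)
  qed (use u in \<open>auto intro!: integrable_p tendsto_p_L1\<close>)
  moreover have "(\<lambda>x. (indicator {0<..} x * f x) * p t x) = (\<lambda>x. f x * p t x)" for f t
    by (auto simp: p_def indicator_def)
  ultimately show ?thesis by simp
qed

text \<open>One criterion for \<open>S\<close>, \<open>K\<close> and \<open>D\<close>. The point
  \<open>x = w\<close> is exempted because the indicator kernel of \<open>S\<close> jumps there; the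
  bound \<open>max 1 w\<close> fits the indicator as well as the kernels that grow like
  \<open>w\<close>.\<close>

lemma continuous_on_integral_p:
  fixes g :: "real \<Rightarrow> real \<Rightarrow> real"
  assumes [measurable]: "\<And>w. g w \<in> borel_measurable borel"
    and bound: "\<And>w x. 0 < w \<Longrightarrow> 0 < x \<Longrightarrow> \<bar>g w x\<bar> \<le> max 1 w"
    and lim: "\<And>v w x. 0 < w \<Longrightarrow> 0 < x \<Longrightarrow> x \<noteq> w \<Longrightarrow> v \<longlonglongrightarrow> w \<Longrightarrow> (\<lambda>n. g (v n) x) \<longlonglongrightarrow> g w x"
  shows "continuous_on ({0<..} \<times> T) (\<lambda>(w, t). \<integral>x. g w x * p t x \<partial>lborel)"
proof (rule continuous_on_sequentiallyI)
  fix u :: "nat \<Rightarrow> real \<times> real" and c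
  assume u: "\<forall>n. u n \<in> {0<..} \<times> T" "c \<in> {0<..} \<times> T" "u \<longlonglongrightarrow> c"
  have l: "(\<lambda>n. fst (u n)) \<longlonglongrightarrow> fst c" "(\<lambda>n. snd (u n)) \<longlonglongrightarrow> snd c"
    using u(3) by (auto intro: tendsto_fst tendsto_snd)
  obtain B where B: "\<And>n. \<bar>fst (u n)\<bar> \<le> B"
    using convergent_imp_Bseq[of "\<lambda>n. fst (u n)"] l(1) by (auto simp: convergent_def Bseq_def)
  have pos: "0 < fst (u n)" "snd (u n) \<in> T" "0 < fst c" "snd c \<in> T" for n
    using u(1)[rule_format, of n] u(2) by auto
  have "AE x in lborel. x \<noteq> fst c" by (rule AE_lborel_singleton)
  then have "(\<lambda>n. \<integral>x. g (fst (u n)) x * p (snd (u n)) x \<partial>lborel) \<longlonglongrightarrow>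
        (\<integral>x. g (fst c) x * p (snd c) x \<partial>lborel)"
  proof (intro tendsto_integral_p[where C="max 1 B"])
    fix n and x :: real assume "0 < x"
    then have "\<bar>g (fst (u n)) x\<bar> \<le> max 1 (fst (u n))" using bound pos by auto
    also have "\<dots> \<le> max 1 B" using B[of n] by (auto simp: max_def)
    finally show "\<bar>g (fst (u n)) x\<bar> \<le> max 1 B" .
  next
    show "AE x in lborel. 0 < x \<longrightarrow> (\<lambda>n. g (fst (u n)) x) \<longlonglongrightarrow> g (fst c) x" if "AE x in lborel. x \<noteq> fst c"
      using that by eventually_elim (use lim pos l in blast)
  qed (use pos l in auto)
  then show "(\<lambda>n. case u n of (w, t) \<Rightarrow> \<integral>x. g w x * p t x \<partial>lborel) \<longlonglongrightarrow>
      (case c of (w, t) \<Rightarrow> \<integral>x. g w x * p t x \<partial>lborel)" by (simp add: split_beta)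
qed

lemma D_eq: "D w t = \<gamma> / 2 * (\<integral>x. kap (min w x) * p t x \<partial>lborel)"
  unfolding D_def diffusion_def set_lebesgue_integral_def
  by (simp add: kap_min p_def mult_ac)

lemma continuous_S: "continuous_on ({0<..} \<times> T) (\<lambda>(w, t). S w t)"
  unfolding S_def
proof (rule continuous_on_integral_p)
  fix v and w x :: real assume x: "x \<noteq> w" "v \<longlonglongrightarrow> w"
  have "\<forall>\<^sub>F n in sequentially. indicator {v n<..} x = (indicator {w<..} x :: real)"
  proof (cases "x < w")
    case True
    show ?thesis using order_tendstoD(1)[OF x(2) True] by eventually_elim (use True in \<open>auto simp: indicator_def\<close>)
  next
    case False
    then have "w < x" using x by simp
    show ?thesis using order_tendstoD(2)[OF x(2) \<open>w < x\<close>]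
      by eventually_elim (use \<open>w < x\<close> in \<open>auto simp: indicator_def\<close>)
  qed
  then show "(\<lambda>n. indicator {v n<..} x) \<longlonglongrightarrow> (indicator {w<..} x :: real)"
    by (rule tendsto_eventually)
qed (auto simp: indicator_def)

lemma continuous_K: "continuous_on ({0<..} \<times> T) (\<lambda>(w, t). K w t)"
  unfolding K_def
  by (rule continuous_on_integral_p) (auto intro!: tendsto_intros)

lemma continuous_D: "continuous_on ({0<..} \<times> T) (\<lambda>(w, t). D w t)"
proof -
  have "continuous_on ({0<..} \<times> T) (\<lambda>(w, t). \<integral>x. kap (min w x) * p t x \<partial>lborel)"
  proof (rule continuous_on_integral_p)
    fix w x :: real assume "0 < w" "0 < x"
    then show "\<bar>kap (min w x)\<bar> \<le> max 1 w"
      using abs_kap_min_le(1)[of w x] by linarith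
  next
    fix v and w x :: real assume "v \<longlonglongrightarrow> w"
    then have "(\<lambda>n. min (v n) x) \<longlonglongrightarrow> min w x" by (intro tendsto_intros)
    then show "(\<lambda>n. kap (min (v n) x)) \<longlonglongrightarrow> kap (min w x)"
      by (rule continuous_on_tendsto_compose[OF continuous_kap]) auto
  qed auto
  then show ?thesis unfolding D_eq split_beta by (intro continuous_intros)
qed

lemma continuous_a: "continuous_on ({0<..} \<times> T) (\<lambda>(w, t). a w t)"
  using continuous_on_mult[OF continuous_D cont] unfolding a_def by (simp add: split_beta)

section \<open>The mass above a given wealth\<close>

lemma integrable_indicator_p:
  assumes "t \<in> T" "A \<in> sets borel"
  shows "integrable lborel (\<lambda>x. indicator A x * p t x)"
  by (rule integrable_mult_p[OF assms(1), where C=0 and C'=1]) (use assms in \<open>auto simp: indicator_def\<close>)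

lemma S_nonneg: "t \<in> T \<Longrightarrow> 0 \<le> S w t"
  unfolding S_def by (intro integral_nonneg_AE AE_I2) (auto simp: p_nonneg)

lemma S_le_1: assumes "t \<in> T" shows "S w t \<le> 1"
proof -
  have "S w t \<le> (\<integral>x. p t x \<partial>lborel)" unfolding S_def
    using assms
    by (intro integral_mono integrable_indicator_p integrable_p) (auto simp: p_nonneg indicator_def)
  then show ?thesis using integral_p assms by simp
qed

lemma S_antimono: assumes "t \<in> T" "v \<le> w" shows "S w t \<le> S v t"
  unfolding S_def
  using assms
  by (intro integral_mono integrable_indicator_p integrable_p) (auto simp: p_nonneg indicator_def)

lemma continuous_rho: "t \<in> T \<Longrightarrow> continuous_on {0<..} (\<lambda>w. \<rho> w t)"
  by (rule continuous_on_compose2[OF cont, of "{0<..}" "\<lambda>w. (w, t)", unfolded split_beta fst_conv snd_conv])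
     (auto intro!: continuous_intros)

lemma tail_p:
  "0 < w \<Longrightarrow> (\<integral>x. indicator {w<..} x * (g x * p t x) \<partial>lborel) = (\<integral>x. indicator {w<..} x * (g x * \<rho> x t) \<partial>lborel)"
  by (intro Bochner_Integration.integral_cong) (auto simp: p_def indicator_def)

lemma S_has_derivative:
  assumes "t \<in> T" "0 < w"
  shows "((\<lambda>v. S v t) has_real_derivative - \<rho> w t) (at w)"
proof -
  have "((\<lambda>v. \<integral>x. indicator {v<..} x * \<rho> x t \<partial>lborel) has_real_derivative - \<rho> w t) (at w)"
    by (rule tail_integral_has_derivative)
       (use assms integrable_p[of t] in \<open>auto intro!: continuous_rho simp: p_def[abs_def]\<close>)
  then show ?thesis
    by (rule has_field_derivative_transform_within_open[where S="{0<..}"])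
       (use assms tail_p[where g="\<lambda>_. 1"] in \<open>auto simp: S_def\<close>)
qed

section \<open>Derivative and two-sided bounds of the diffusion coefficient\<close>

lemma integrable_kap_p:
  assumes "t \<in> T" shows "integrable lborel (\<lambda>x. kap x * p t x)"
  by (rule integrable_mult_p[OF assms, where C=1 and C'=0])
     (use kap_bounds in \<open>auto simp: less_imp_le\<close>)

text \<open>Splitting at \<open>x = w\<close>, where \<open>min w x\<close> changes branch, leaves
  only a constant, a tail integral and \<open>S\<close>, whose derivatives are known.\<close>

lemma D_split:
  assumes "t \<in> T" "0 < w"
  shows "D w t = \<gamma> / 2 * ((\<integral>x. kap x * p t x \<partial>lborel)
           - (\<integral>x. indicator {w<..} x * (kap x * \<rho> x t) \<partial>lborel) + kap w * S w t)"
proof -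
  have i: "integrable lborel (\<lambda>x. indicator {w<..} x * (kap x * p t x))"
    using integrable_mult_indicator[OF _ integrable_kap_p[OF assms(1)], of "{w<..}"] by simp
  have "(\<integral>x. kap (min w x) * p t x \<partial>lborel) = (\<integral>x. kap x * p t x
      - indicator {w<..} x * (kap x * p t x) + kap w * (indicator {w<..} x * p t x) \<partial>lborel)"
    by (intro Bochner_Integration.integral_cong) (auto simp: indicator_def min_def)
  also have "\<dots> = (\<integral>x. kap x * p t x \<partial>lborel)
      - (\<integral>x. indicator {w<..} x * (kap x * p t x) \<partial>lborel) + kap w * S w t"
    using integrable_kap_p[OF assms(1)] i integrable_indicator_p[OF assms(1)]
    by (simp add: S_def)
  finally show ?thesis using tail_p[OF assms(2)] by (simp add: D_eq)
qed

text \<open>The terms \<open>kap w * \<rho> w t\<close> coming from the tail integral and from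
  \<open>S\<close> cancel, so only the derivative of \<open>kap\<close> times \<open>S\<close>
  remains.\<close>

lemma D_has_derivative:
  assumes "t \<in> T" "0 < w" "w \<noteq> 1"
  shows "((\<lambda>v. D v t) has_real_derivative \<gamma> / 2 * (if w < 1 then 2 * w else 1) * S w t) (at w)"
proof -
  have c: "continuous_on {0<..} (\<lambda>x. kap x * \<rho> x t)"
    by (intro continuous_on_mult continuous_on_subset[OF continuous_kap] continuous_rho assms) simp
  have i: "integrable lborel (\<lambda>x. indicator {0<..} x * (kap x * \<rho> x t))"
    using integrable_kap_p[OF assms(1)] by (simp add: p_def mult.left_commute)
  have "((\<lambda>w. \<gamma> / 2 * ((\<integral>x. kap x * p t x \<partial>lborel)
           - (\<integral>x. indicator {w<..} x * (kap x * \<rho> x t) \<partial>lborel) + kap w * S w t)) has_real_derivative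
        \<gamma> / 2 * (0 - - (kap w * \<rho> w t) + (kap w * - \<rho> w t + (if w < 1 then 2 * w else 1) * S w t))) (at w)"
    by (intro DERIV_cmult DERIV_add DERIV_diff DERIV_const tail_integral_has_derivative[OF c i]
        DERIV_mult' kap_has_derivative S_has_derivative assms)
  then have "((\<lambda>w. \<gamma> / 2 * ((\<integral>x. kap x * p t x \<partial>lborel)
           - (\<integral>x. indicator {w<..} x * (kap x * \<rho> x t) \<partial>lborel) + kap w * S w t)) has_real_derivative
        \<gamma> / 2 * (if w < 1 then 2 * w else 1) * S w t) (at w)"
    by (simp add: mult.assoc)
  then show ?thesis
    by (rule has_field_derivative_transform_within_open[where S="{0<..}"])
       (use assms D_split in auto)
qed

text \<open>The first bound uses \<open>kap (min w x) \<le> x\<close> and the unit mean, the second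
  \<open>kap (min w x) \<le> kap w\<close> and the unit mass. They serve at large and at small
  wealth respectively.\<close>

lemma D_upper:
  assumes "t \<in> T" "0 < w" shows "D w t \<le> \<gamma> / 2" and "D w t \<le> \<gamma> / 2 * kap w"
proof -
  have i: "integrable lborel (\<lambda>x. kap (min w x) * p t x)"
    by (rule integrable_mult_p[OF assms(1), where C=1 and C'=0])
       (use assms abs_kap_min_le(2) in auto)
  have "(\<integral>x. kap (min w x) * p t x \<partial>lborel) \<le> (\<integral>x. x * p t x \<partial>lborel)"
  proof (intro integral_mono i integrable_xp assms)
    fix x show "kap (min w x) * p t x \<le> x * p t x"
      using assms kap_bounds(2)[of "min w x"] p_nonneg[OF assms(1), of x] p_zero[OF assms(1), of x]
      by (cases "0 < x") (auto intro!: mult_right_mono)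
  qed
  then show "D w t \<le> \<gamma> / 2" using gamma_pos assms by (simp add: D_eq integral_xp)
  have "(\<integral>x. kap (min w x) * p t x \<partial>lborel) \<le> (\<integral>x. kap w * p t x \<partial>lborel)"
  proof (intro integral_mono i integrable_mult_right integrable_p assms)
    fix x show "kap (min w x) * p t x \<le> kap w * p t x"
      using assms kap_mono[of "min w x" w] p_nonneg[OF assms(1), of x] p_zero[OF assms(1), of x]
      by (cases "0 < x") (auto intro!: mult_right_mono)
  qed
  then show "D w t \<le> \<gamma> / 2 * kap w" using gamma_pos assms by (simp add: D_eq integral_p)
qed

text \<open>Only agents above \<open>v\<close> are counted, and for each of them the kernel is at
  least \<open>kap v\<close>. This gives the ellipticity constant \<open>m\<close> of the gradient
  estimate.\<close>

lemma D_lower: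
  assumes "t \<in> T" "0 < v" "v \<le> w" shows "\<gamma> / 2 * (kap v * S v t) \<le> D w t"
proof -
  have i: "integrable lborel (\<lambda>x. kap (min w x) * p t x)"
    by (rule integrable_mult_p[OF assms(1), where C=1 and C'=0])
       (use assms abs_kap_min_le(2) in auto)
  have "kap v * S v t = (\<integral>x. kap v * (indicator {v<..} x * p t x) \<partial>lborel)"
    by (simp add: S_def)
  also have "\<dots> \<le> (\<integral>x. kap (min w x) * p t x \<partial>lborel)"
  proof (intro integral_mono i integrable_mult_right integrable_indicator_p assms)
    fix x
    have "kap v * indicator {v<..} x \<le> kap (min w x)" if "0 < x"
      using assms kap_mono[of v "min w x"] kap_bounds(1)[of "min w x"] that
      by (cases "v < x") simp_all
    then have "kap v * indicator {v<..} x * p t x \<le> kap (min w x) * p t x"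
      using p_nonneg[OF assms(1), of x] p_zero[OF assms(1), of x]
      by (cases "0 < x") (simp_all add: mult_right_mono)
    then show "kap v * (indicator {v<..} x * p t x) \<le> kap (min w x) * p t x"
      by (simp add: mult.assoc)
  qed auto
  finally show ?thesis using gamma_pos by (simp add: D_eq)
qed

lemma D_nonneg: "t \<in> T \<Longrightarrow> 0 < w \<Longrightarrow> 0 \<le> D w t"
proof -
  assume *: "t \<in> T" "0 < w"
  have "0 \<le> \<gamma> / 2 * (kap w * S w t)"
    using gamma_pos kap_bounds(1)[of w] S_nonneg[of t w] * by simp
  with D_lower[OF *] show ?thesis by force
qed

lemma a_nonneg: "t \<in> T \<Longrightarrow> 0 < w \<Longrightarrow> 0 \<le> a w t"
  by (simp add: a_def D_nonneg rho_nonneg)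

end

subsection \<open>Time evolution of the integrated density\<close>

lemma integral_bounded_imp_not_eventually_ge:
  fixes f :: "real \<Rightarrow> real"
  assumes cont: "continuous_on {b..} f" and nonneg: "\<And>w. b \<le> w \<Longrightarrow> 0 \<le> f w"
    and bound: "\<And>N. b \<le> N \<Longrightarrow> integral {b..N} f \<le> C" and "0 < e"
  shows "\<not> (\<forall>\<^sub>F w in at_top. e \<le> f w)"
proof
  assume "\<forall>\<^sub>F w in at_top. e \<le> f w"
  then obtain W where W: "\<And>w. W \<le> w \<Longrightarrow> e \<le> f w" by (auto simp: eventually_at_top_linorder)
  define V where "V = max W b"
  \<comment> \<open>The length of \<open>{V..N}\<close> makes the constant \<open>e\<close>
    integrate to \<open>\<bar>C\<bar> + 1\<close>, which exceeds the bound \<open>C\<close>.\<close>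
  define N where "N = V + (\<bar>C\<bar> + 1) / e"
  have N: "V \<le> N" "b \<le> V" "W \<le> V" "e * (N - V) = \<bar>C\<bar> + 1"
    using \<open>0 < e\<close> by (auto simp: N_def V_def)
  have int: "f integrable_on {c..N}" if "b \<le> c" for c
    by (rule integrable_continuous_real[OF continuous_on_subset[OF cont]]) (use that in auto)
  have "\<bar>C\<bar> + 1 = integral {V..N} (\<lambda>_. e)" using N by (simp add: mult.commute)
  also have "\<dots> \<le> integral {V..N} f"
    using N W by (intro integral_le int) auto
  also have "\<dots> \<le> integral {b..N} f"
    using N nonneg by (intro integral_subset_le int) auto
  also have "\<dots> \<le> C" using bound N by auto
  finally show False by simp
qed

text \<open>Up to a vanishing term, \<open>f\<close> is minus an affine function. A positive leading
  coefficient would make \<open>f\<close> negative far out, a negative one would keep it above a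
  positive constant, against the bounded integrals. This applies first to \<open>B\<close>, then to
  \<open>A\<close>.\<close>

lemma affine_zero_if_integral_bounded:
  fixes f d :: "real \<Rightarrow> real"
  assumes cont: "continuous_on {b..} f" and nonneg: "\<And>w. b \<le> w \<Longrightarrow> 0 \<le> f w"
    and bound: "\<And>N. b \<le> N \<Longrightarrow> integral {b..N} f \<le> C"
    and d: "(d \<longlongrightarrow> 0) at_top"
    and f: "\<And>w. b \<le> w \<Longrightarrow> f w = d w - (A + B * (w - b))"
  shows "A = 0" "B = 0"
proof -
  have fd: "\<forall>\<^sub>F w in at_top. f w = d w - (A + B * (w - b))"
    using eventually_ge_at_top[of b] by eventually_elim (rule f)
  have nn: "\<forall>\<^sub>F w in at_top. 0 \<le> f w"
    using eventually_ge_at_top[of b] by eventually_elim (rule nonneg)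
  have d1: "\<forall>\<^sub>F w in at_top. \<bar>d w\<bar> < e" if "0 < e" for e
    using tendstoD[OF d that] by simp
  note no = integral_bounded_imp_not_eventually_ge[OF cont nonneg bound]
  show B0: "B = 0"
  proof (rule ccontr)
    assume "B \<noteq> 0"
    then consider "B < 0" | "B > 0" by linarith
    then show False
    proof cases
      case 1
      have "\<forall>\<^sub>F w in at_top. b + (2 + A) / (- B) \<le> w" by (rule eventually_ge_at_top)
      then have "\<forall>\<^sub>F w in at_top. 1 \<le> f w"
        using fd d1[OF zero_less_one]
      proof eventually_elim
        case (elim w)
        then have "(2 + A) / (- B) \<le> w - b" by linarith
        then have "2 + A \<le> (w - b) * (- B)" using 1 by (subst (asm) pos_divide_le_eq) auto
        then have "2 + A \<le> - (B * (w - b))" by (simp add: mult.commute)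
        then show ?case using elim by linarith
      qed
      with no[of 1] show False by simp
    next
      case 2
      have "\<forall>\<^sub>F w in at_top. b + (2 - A) / B \<le> w" by (rule eventually_ge_at_top)
      then have "\<forall>\<^sub>F w :: real in at_top. False"
        using fd d1[OF zero_less_one] nn
      proof eventually_elim
        case (elim w)
        then have "(2 - A) / B \<le> w - b" by linarith
        then have "2 - A \<le> (w - b) * B" using 2 by (subst (asm) pos_divide_le_eq) auto
        then have "2 - A \<le> B * (w - b)" by (simp add: mult.commute)
        then show ?case using elim by linarith
      qed
      then show False by simp
    qed
  qed
  show "A = 0"
  proof (rule ccontr)
    assume "A \<noteq> 0"
    then consider "A < 0" | "A > 0" by linarith
    then show False
    proof cases
      case 1
      have "\<forall>\<^sub>F w in at_top. - A / 2 \<le> f w"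
        using d1[of "- A / 2", simplified, OF 1] fd by eventually_elim (use 1 B0 in auto)
      with no[of "- A / 2"] 1 show False by simp
    next
      case 2
      have "\<forall>\<^sub>F w :: real in at_top. False"
        using d1[OF 2] fd nn by eventually_elim (use 2 B0 in auto)
      then show False by simp
    qed
  qed
qed

lemma has_derivative_from_integral_increment:
  fixes f g :: "real \<Rightarrow> real"
  assumes "open U" "t \<in> U" and cont: "continuous_on U g"
    and inc: "\<And>s t. s \<le> t \<Longrightarrow> {s..t} \<subseteq> U \<Longrightarrow> f s - f t = integral {s..t} g"
  shows "(f has_real_derivative - g t) (at t)"
proof -
  obtain e where e: "e > 0" "cball t e \<subseteq> U"
    using assms open_contains_cball by blast
  then have sub: "{t - e..t + e} \<subseteq> U" by (simp add: cball_eq_atLeastAtMost)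
  have "((\<lambda>s. f (t - e) - integral {t - e..s} g) has_real_derivative 0 - g t) (at t within {t - e..t + e})"
    by (intro DERIV_diff DERIV_const integral_has_real_derivative continuous_on_subset[OF cont sub])
       (use e in auto)
  moreover have "at t within {t - e..t + e} = at t" using e by (intro at_within_Icc_at) auto
  ultimately have "((\<lambda>s. f (t - e) - integral {t - e..s} g) has_real_derivative - g t) (at t)" by simp
  then show ?thesis
  proof (rule has_field_derivative_transform_within_open[where S="{t - e<..<t + e}"])
    fix s assume s: "s \<in> {t - e<..<t + e}"
    have "{t - e..s} \<subseteq> U" using s sub by auto
    from inc[OF _ this] s show "f (t - e) - integral {t - e..s} g = f s" by simp
  qed (use e in auto)
qed

context ysm_solution
begin

lemma interior_sub: "t \<in> interior T \<Longrightarrow> t \<in> T"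
  using interior_subset by (rule subsetD)

lemma convex_interior_T: "convex (interior T)"
  using interval unfolding is_interval_convex_1 by (rule convex_interior)

section \<open>Second-order Taylor formulas in wealth\<close>

lemma integrable_min_p:
  assumes "t \<in> T" "0 < w" shows "integrable lborel (\<lambda>x. min w x * p t x)"
  by (rule integrable_mult_p[OF assms(1), where C=1 and C'=0]) (use assms in auto)

text \<open>Taylor's formula for \<open>K\<close> at \<open>b\<close> with integral remainder, where
  \<open>S\<close> is the first wealth derivative and minus the density the second. It is checked
  pointwise under the integral.\<close>

lemma K_expand:
  assumes "t \<in> T" "0 < b" "b \<le> w"
  shows "K w t = K b t + (w - b) * S b t - integral {b..w} (\<lambda>x. (w - x) * \<rho> x t)"
proof -
  have c: "continuous_on {b..w} (\<lambda>x. (w - x) * \<rho> x t)"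
    by (intro continuous_intros continuous_on_subset[OF continuous_rho]) (use assms in auto)
  note ic = integral_Icc_eq_lborel[OF c]
  note [measurable] = p_measurable[OF assms(1)]
  have "K w t = (\<integral>x. min b x * p t x + (w - b) * (indicator {b<..} x * p t x)
      - indicator {b..w} x * ((w - x) * \<rho> x t) \<partial>lborel)"
    unfolding K_def
  proof (rule Bochner_Integration.integral_cong_AE)
    \<comment> \<open>At \<open>x = b\<close> the pointwise identity can fail, because
      \<open>{b..w}\<close> contains \<open>b\<close> while \<open>{b<..}\<close> does not.\<close>
    have "AE x in lborel. x \<noteq> b" by (rule AE_lborel_singleton)
    then show "AE x in lborel. min w x * p t x = min b x * p t x + (w - b) * (indicator {b<..} x * p t x)
      - indicator {b..w} x * ((w - x) * \<rho> x t)"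
    proof eventually_elim
      case (elim x)
      consider "x < b" | "b < x" "x \<le> w" | "w < x" using elim by linarith
      then show ?case
        by cases (use assms in \<open>auto simp: indicator_def p_def algebra_simps\<close>)
    qed
    show "(\<lambda>x. min b x * p t x + (w - b) * (indicator {b<..} x * p t x)
      - indicator {b..w} x * ((w - x) * \<rho> x t)) \<in> borel_measurable lborel"
      using borel_measurable_integrable[OF ic(1)] by measurable
  qed measurable
  also have "\<dots> = K b t + (w - b) * S b t - integral {b..w} (\<lambda>x. (w - x) * \<rho> x t)"
    using integrable_min_p[of t b] integrable_indicator_p[OF assms(1), of "{b<..}"] ic assms
    by (simp add: K_def S_def)
  finally show ?thesis .
qed

lemma a_has_derivative:
  "0 < w \<Longrightarrow> t \<in> interior T \<Longrightarrow> ((\<lambda>v. a v t) has_real_derivative J w t) (at w)"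
  using deriv_flux by (simp add: a_def D_def)

text \<open>The counterpart of \<open>K_expand\<close> for \<open>a\<close>, whose second wealth
  derivative is \<open>\<rho>t\<close>. The weight \<open>w - x\<close> vanishes at the upper end,
  so \<open>J\<close> enters only at \<open>b\<close>.\<close>

lemma flux_taylor:
  assumes "t \<in> interior T" "0 < b" "b \<le> w"
  shows "((\<lambda>x. (w - x) * \<rho>t x t) has_integral (a w t - a b t - J b t * (w - b))) {b..w}"
proof -
  have "((\<lambda>x. (w - x) * \<rho>t x t) has_integral
      ((w - w) * J w t + a w t) - ((w - b) * J b t + a b t)) {b..w}"
  proof (rule fundamental_theorem_of_calculus[OF assms(3)])
    fix x assume x: "x \<in> {b..w}"
    have "((\<lambda>x. (w - x) * J x t + a x t) has_real_derivative
        ((w - x) * \<rho>t x t + (0 - 1) * J x t + J x t)) (at x)"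
      by (intro DERIV_add DERIV_mult' DERIV_diff DERIV_const DERIV_ident deriv_J a_has_derivative)
         (use x assms in auto)
    then have "((\<lambda>x. (w - x) * J x t + a x t) has_real_derivative (w - x) * \<rho>t x t) (at x)"
      by simp
    then show "((\<lambda>x. (w - x) * J x t + a x t) has_vector_derivative (w - x) * \<rho>t x t) (at x within {b..w})"
      unfolding has_real_derivative_iff_has_vector_derivative by (rule has_vector_derivative_at_within)
  qed
  then show ?thesis by (simp add: algebra_simps)
qed

section \<open>Time dependence of the flux and of weighted masses\<close>

lemma continuous_in_time:
  fixes f :: "real \<Rightarrow> real \<Rightarrow> real"
  assumes "continuous_on ({0<..} \<times> V) (\<lambda>(w, t). f w t)" "0 < w"
  shows "continuous_on V (f w)"
  by (rule continuous_on_compose2[OF assms(1), of V "\<lambda>t. (w, t)", unfolded split_beta fst_conv snd_conv])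
     (use assms in \<open>auto intro!: continuous_intros\<close>)

lemma continuous_a_time: "0 < w \<Longrightarrow> V \<subseteq> T \<Longrightarrow> continuous_on V (a w)"
  by (rule continuous_on_subset[OF continuous_in_time[OF continuous_a]])

lemma continuous_weighted_rt:
  assumes "0 < b"
  shows "continuous_on (interior T \<times> cbox b w) (\<lambda>(t, x). (w - x) * \<rho>t x t)"
proof -
  have "continuous_on (interior T \<times> cbox b w) (\<lambda>z. (\<lambda>(w, t). \<rho>t w t) (snd z, fst z))"
    by (rule continuous_on_compose2[OF cont_rt]) (use assms in \<open>auto intro!: continuous_intros\<close>)
  then show ?thesis unfolding split_beta by (intro continuous_intros) simp
qed

text \<open>Solving \<open>flux_taylor\<close> on \<open>{b..b + 1}\<close> for \<open>J b t\<close>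
  expresses it through quantities already known to be continuous in time.\<close>

lemma continuous_J_time:
  assumes "0 < b" shows "continuous_on (interior T) (J b)"
proof -
  have "continuous_on (interior T) (\<lambda>t. a (b + 1) t - a b t - integral (cbox b (b + 1)) (\<lambda>x. (b + 1 - x) * \<rho>t x t))"
    by (intro continuous_intros continuous_a_time interior_subset integral_continuous_on_param
        continuous_weighted_rt) (use assms in auto)
  then show ?thesis
    by (rule continuous_on_eq) (use flux_taylor[of _ b "b + 1", THEN integral_unique] assms in simp)
qed

lemma weighted_mass_has_derivative:
  assumes "t \<in> interior T" "0 < b" "b \<le> w"
  shows "((\<lambda>s. integral {b..w} (\<lambda>x. (w - x) * \<rho> x s)) has_real_derivative
           (a w t - a b t - J b t * (w - b))) (at t)"
proof -
  have "((\<lambda>s. integral (cbox b w) (\<lambda>x. (w - x) * \<rho> x s)) has_real_derivative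
      integral (cbox b w) (\<lambda>x. (w - x) * \<rho>t x t)) (at t within interior T)"
  proof (rule leibniz_rule_field_derivative)
    fix s x assume "s \<in> interior T" "x \<in> cbox b w"
    then show "((\<lambda>s. (w - x) * \<rho> x s) has_real_derivative (w - x) * \<rho>t x s) (at s within interior T)"
      using assms by (intro DERIV_cmult has_field_derivative_at_within[OF deriv_t]) auto
  next
    fix s assume "s \<in> interior T"
    then show "(\<lambda>x. (w - x) * \<rho> x s) integrable_on cbox b w"
      by (intro integrable_continuous continuous_intros continuous_on_subset[OF continuous_rho] interior_sub)
         (use assms in auto)
  qed (use assms convex_interior_T continuous_weighted_rt in auto)
  then show ?thesis
    using flux_taylor[OF assms, THEN integral_unique] assms
    by (simp add: at_within_open[OF _ open_interior])
qed

text \<open>Dominated convergence with majorant \<open>x * p t x\<close>. The limit is the conserved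
  mean, so differences of \<open>K\<close> between two times vanish at infinity.\<close>

lemma tendsto_K_at_top:
  assumes "t \<in> T" shows "((\<lambda>w. K w t) \<longlongrightarrow> 1) at_top"
proof -
  note [measurable] = p_measurable[OF assms]
  have "((\<lambda>w. \<integral>x. min w x * p t x \<partial>lborel) \<longlongrightarrow> (\<integral>x. x * p t x \<partial>lborel)) at_top"
  proof (rule integral_dominated_convergence_at_top[where w="\<lambda>x. x * p t x"])
    show "AE x in lborel. ((\<lambda>w. min w x * p t x) \<longlongrightarrow> x * p t x) at_top"
    proof (intro AE_I2)
      fix x :: real
      have "\<forall>\<^sub>F w in at_top. min w x * p t x = x * p t x"
        using eventually_ge_at_top[of x] by eventually_elim simp
      then show "((\<lambda>w. min w x * p t x) \<longlongrightarrow> x * p t x) at_top" by (rule tendsto_eventually)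
    qed
    show "\<forall>\<^sub>F w in at_top. AE x in lborel. norm (min w x * p t x) \<le> x * p t x"
      using eventually_ge_at_top[of 0]
    proof eventually_elim
      case (elim w)
      have "norm (min w x * p t x) \<le> x * p t x" for x
        using elim p_nonneg[OF assms, of x] p_zero[OF assms, of x]
        by (cases "0 < x") (auto simp: abs_mult intro!: mult_right_mono)
      then show ?case by simp
    qed
  qed (use integrable_xp[OF assms] in auto)
  then show ?thesis using integral_xp[OF assms] by (simp add: K_def)
qed

lemma integral_rho_le_1:
  assumes "t \<in> T" "0 < b" shows "integral {b..w} (\<lambda>x. \<rho> x t) \<le> 1"
proof -
  have "continuous_on {b..w} (\<lambda>x. \<rho> x t)"
    by (rule continuous_on_subset[OF continuous_rho]) (use assms in auto)
  note ic = integral_Icc_eq_lborel[OF this]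
  have "integral {b..w} (\<lambda>x. \<rho> x t) \<le> (\<integral>x. p t x \<partial>lborel)"
    unfolding ic(2)[symmetric]
  proof (intro integral_mono ic integrable_p assms)
    fix x show "indicator {b..w} x * \<rho> x t \<le> p t x"
      using assms p_nonneg[OF assms(1), of x] by (auto simp: indicator_def p_def)
  qed
  then show ?thesis using integral_p[OF assms(1)] by simp
qed

lemma increments:
  assumes "s \<le> t" "{s..t} \<subseteq> interior T" "0 < b"
  shows K_increment: "K b s - K b t = integral {s..t} (a b)"
    and S_increment: "S b s - S b t = integral {s..t} (J b)"
proof -
  have sT: "{s..t} \<subseteq> T" "s \<in> T" "t \<in> T" using assms interior_sub by auto
  define R where "R = (\<lambda>w. integral {s..t} (a w))"
  \<comment> \<open>\<open>A\<close> and \<open>B\<close> are the errors in the two claims at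
    \<open>b\<close>. Integrating the weighted mass in time and inserting \<open>K_expand\<close> at
    both times makes them the coefficients of an affine function of \<open>w\<close>.\<close>
  define A where "A = K b s - K b t - integral {s..t} (a b)"
  define B where "B = S b s - S b t - integral {s..t} (J b)"
  have inta: "a w integrable_on {s..t}" if "0 < w" for w
    by (rule integrable_continuous_real[OF continuous_a_time]) (use that sT in auto)
  have intJ: "J b integrable_on {s..t}"
    by (rule integrable_continuous_real[OF continuous_on_subset[OF continuous_J_time]]) (use assms in auto)
  have R: "R w = (K w s - K w t) - (A + B * (w - b))" if "b \<le> w" for w
  proof -
    have "((\<lambda>\<tau>. a w \<tau> - a b \<tau> - J b \<tau> * (w - b)) has_integral
        (integral {b..w} (\<lambda>x. (w - x) * \<rho> x t) - integral {b..w} (\<lambda>x. (w - x) * \<rho> x s))) {s..t}"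
    proof (rule fundamental_theorem_of_calculus[OF assms(1)])
      fix \<tau> assume "\<tau> \<in> {s..t}"
      then have "\<tau> \<in> interior T" using assms by auto
      from weighted_mass_has_derivative[OF this assms(3) that]
      show "((\<lambda>\<tau>. integral {b..w} (\<lambda>x. (w - x) * \<rho> x \<tau>)) has_vector_derivative
          (a w \<tau> - a b \<tau> - J b \<tau> * (w - b))) (at \<tau> within {s..t})"
        unfolding has_real_derivative_iff_has_vector_derivative by (rule has_vector_derivative_at_within)
    qed
    then have "integral {b..w} (\<lambda>x. (w - x) * \<rho> x t) - integral {b..w} (\<lambda>x. (w - x) * \<rho> x s) =
        integral {s..t} (\<lambda>\<tau>. a w \<tau> - a b \<tau> - J b \<tau> * (w - b))"
      by (simp add: integral_unique)
    also have "\<dots> = R w - integral {s..t} (a b) - integral {s..t} (J b) * (w - b)"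
      using inta[of w] inta[of b] intJ that assms
      by (simp add: R_def integral_diff integrable_diff integrable_on_mult_left)
    finally show ?thesis
      unfolding A_def B_def K_expand[OF sT(2) assms(3) that] K_expand[OF sT(3) assms(3) that]
      by (simp add: algebra_simps)
  qed
  have cont2: "continuous_on ({b..} \<times> cbox s t) (\<lambda>(w, \<tau>). a w \<tau>)"
    by (rule continuous_on_subset[OF continuous_a]) (use assms sT in auto)
  have contR: "continuous_on {b..} R"
    unfolding R_def using integral_continuous_on_param[OF cont2] by simp
  have R0: "0 \<le> R w" if "b \<le> w" for w
    unfolding R_def using that assms sT
    by (intro Henstock_Kurzweil_Integration.integral_nonneg inta a_nonneg) auto
  \<comment> \<open>After exchanging the integrals, \<open>a \<le> \<gamma> / 2 * \<rho>\<close> and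
    unit mass bound the inner integral by \<open>\<gamma> / 2\<close>, uniformly in
    \<open>N\<close>.\<close>
  have RN: "integral {b..N} R \<le> \<gamma> / 2 * (t - s)" if "b \<le> N" for N
  proof -
    have "continuous_on (cbox (b, s) (N, t)) (\<lambda>(w, \<tau>). a w \<tau>)"
      by (rule continuous_on_subset[OF cont2]) (auto simp: cbox_Pair_eq)
    then have "integral {b..N} R = integral {s..t} (\<lambda>\<tau>. integral {b..N} (\<lambda>w. a w \<tau>))"
      using integral_swap_continuous[of b s N t a] by (simp add: R_def)
    also have "\<dots> \<le> integral {s..t} (\<lambda>_. \<gamma> / 2)"
    proof (rule integral_le)
      have "continuous_on (cbox s t \<times> cbox b N) (\<lambda>z. (\<lambda>(w, \<tau>). a w \<tau>) (snd z, fst z))"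
        by (rule continuous_on_compose2[OF cont2]) (auto intro!: continuous_intros)
      then have "continuous_on (cbox s t) (\<lambda>\<tau>. integral (cbox b N) (\<lambda>w. a w \<tau>))"
        by (intro integral_continuous_on_param) (simp add: split_beta)
      then show "(\<lambda>\<tau>. integral {b..N} (\<lambda>w. a w \<tau>)) integrable_on {s..t}"
        by (intro integrable_continuous_real) simp
      fix \<tau> assume "\<tau> \<in> {s..t}"
      then have \<tau>: "\<tau> \<in> T" using sT by auto
      have c: "continuous_on {b..N} (\<lambda>w. \<rho> w \<tau>)"
        by (rule continuous_on_subset[OF continuous_rho[OF \<tau>]]) (use assms in auto)
      have ca: "continuous_on {b..N} (\<lambda>w. a w \<tau>)"
        by (rule continuous_on_compose2[OF continuous_a, of _ "\<lambda>w. (w, \<tau>)", unfolded split_beta fst_conv snd_conv])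
           (use assms \<tau> in \<open>auto intro!: continuous_intros\<close>)
      have "integral {b..N} (\<lambda>w. a w \<tau>) \<le> integral {b..N} (\<lambda>w. \<gamma> / 2 * \<rho> w \<tau>)"
        unfolding a_def
        by (intro integral_le integrable_continuous_real continuous_intros c ca[unfolded a_def] mult_right_mono
             D_upper rho_nonneg \<tau>) (use assms in auto)
      also have "\<dots> = \<gamma> / 2 * integral {b..N} (\<lambda>w. \<rho> w \<tau>)" by simp
      also have "\<dots> \<le> \<gamma> / 2 * 1"
        using gamma_pos by (intro mult_left_mono integral_rho_le_1 \<tau> assms) auto
      finally show "integral {b..N} (\<lambda>w. a w \<tau>) \<le> \<gamma> / 2" by simp
    qed auto
    finally show ?thesis using assms by (simp add: mult.commute)
  qed
  have "((\<lambda>w. K w s - K w t) \<longlongrightarrow> 1 - 1) at_top"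
    by (intro tendsto_diff tendsto_K_at_top sT)
  then have "((\<lambda>w. K w s - K w t) \<longlongrightarrow> 0) at_top" by simp
  from affine_zero_if_integral_bounded[OF contR R0 RN this R] have "A = 0" "B = 0" by auto
  then show "K b s - K b t = integral {s..t} (a b)" "S b s - S b t = integral {s..t} (J b)"
    by (auto simp: A_def B_def)
qed

section \<open>Time derivatives of \<open>K\<close> and \<open>S\<close>\<close>

lemma K_has_time_derivative:
  assumes "t \<in> interior T" "0 < b"
  shows "(K b has_real_derivative - a b t) (at t)"
  using has_derivative_from_integral_increment[OF open_interior assms(1)
      continuous_a_time[OF assms(2) interior_subset], of "K b"] K_increment assms(2) by blast

lemma S_has_time_derivative:
  assumes "t \<in> interior T" "0 < b"
  shows "(S b has_real_derivative - J b t) (at t)"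
  using has_derivative_from_integral_increment[OF open_interior assms(1)
      continuous_J_time[OF assms(2)], of "S b"] S_increment assms(2) by blast

end

subsection \<open>Local boundedness of the diffused density\<close>

text \<open>Supplies the barrier parameter \<open>k\<close>: its quadratic term must beat the drift
  and localization terms.\<close>

lemma quadratic_dominates_linear:
  fixes b c :: real
  assumes "0 \<le> b" "0 \<le> c"
  obtains k where "1 \<le> k" "c < 16 * k\<^sup>2 - b * k"
proof
  define k where "k = 1 + b + c"
  show "1 \<le> k" using assms by (simp add: k_def)
  then have "k \<le> k\<^sup>2" by (simp add: power2_eq_square)
  moreover have "b * k \<le> k\<^sup>2"
    unfolding power2_eq_square using assms by (intro mult_right_mono) (auto simp: k_def)
  moreover have "c < k" using assms by (simp add: k_def)
  ultimately show "c < 16 * k\<^sup>2 - b * k" using \<open>1 \<le> k\<close> by linarith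
qed

context ysm_solution
begin

text \<open>The level 3/4 lies below the mean 1: with no mass above it the mean would be at most
  3/4.\<close>

lemma S_pos:
  assumes "t \<in> T" shows "0 < S (3/4) t"
proof (rule ccontr)
  assume "\<not> 0 < S (3/4) t"
  then have 0: "(\<integral>x. indicator {3/4<..} x * p t x \<partial>lborel) = 0"
    using S_nonneg[OF assms, of "3/4"] by (simp add: S_def)
  have "AE x in lborel. indicator {3/4<..} x * p t x = 0"
    using integral_nonneg_eq_0_iff_AE[OF integrable_indicator_p[OF assms, of "{3/4<..}"]] 0
    by (simp add: p_nonneg[OF assms])
  then have "AE x in lborel. x * p t x \<le> 3/4 * p t x"
  proof eventually_elim
    case (elim x)
    then show ?case
      using p_nonneg[OF assms, of x] mult_right_mono[of x "3/4" "p t x"]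
      by (cases "3/4 < x") auto
  qed
  then have "(\<integral>x. x * p t x \<partial>lborel) \<le> (\<integral>x. 3/4 * p t x \<partial>lborel)"
    by (intro integral_mono_AE integrable_xp integrable_mult_right integrable_p assms)
  then show False using assms by (simp add: integral_p integral_xp)
qed

text \<open>The hypothesis \<open>1 \<notin> {x0 - r..x0 + r}\<close> avoids the kink of the diffusion coefficient.\<close>
lemma rho_interior_bound:
  assumes pos: "0 < r" "0 < \<delta>" "0 < m" "0 \<le> L" "0 < k"
    and X: "0 < x0 - r" "1 \<notin> {x0 - r..x0 + r}"
    and time: "{t - \<delta>..t} \<subseteq> interior T"
    and Dm: "\<And>x s. x \<in> {x0 - r..x0 + r} \<Longrightarrow> s \<in> {t - \<delta>..t} \<Longrightarrow> m \<le> D x s"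
    and D'L: "\<And>x. x \<in> {x0 - r..x0 + r} \<Longrightarrow> \<gamma> / 2 * (if x < 1 then 2 * x else 1) \<le> L * m"
    and k: "1 \<le> 2 * k * r" "1 < \<delta> * m * (16 * k\<^sup>2 - 4 / r\<^sup>2 - 4 * L * k - 2 * L / r)"
  shows "\<rho> x0 t \<le> 4 * k"
proof -
  define D' where "D' = (\<lambda>x s. \<gamma> / 2 * (if x < 1 then 2 * x else 1) * S x s)"
  \<comment> \<open>The wealth derivative of \<rho>, obtained from the quotient
    \<open>a / D\<close>: the equation makes the product \<open>a\<close> differentiable, and
    dividing is legitimate since \<open>D\<close> is positive near the point.\<close>
  define q where "q = (\<lambda>x s. (J x s - D' x s * \<rho> x s) / D x s)"
  have sub: "0 < x" "x \<noteq> 1" if "x \<in> {x0 - r..x0 + r}" for x using that X by auto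
  have tT: "s \<in> interior T" "s \<in> T" if "s \<in> {t - \<delta>..t}" for s
    using that time interior_sub by blast+
  have Dpos: "0 < D x s" if "x \<in> {x0 - r..x0 + r}" "s \<in> {t - \<delta>..t}" for x s
    using Dm[OF that] pos by simp
  have D'0: "0 \<le> D' x s" if "x \<in> {x0 - r..x0 + r}" "s \<in> {t - \<delta>..t}" for x s
    using sub(1)[OF that(1)] S_nonneg[OF tT(2)[OF that(2)]] gamma_pos by (auto simp: D'_def)
  show ?thesis
  proof (rule interior_gradient_bound[where p=\<rho> and S=S and D=D and D'=D' and q=q and r=r and \<delta>=\<delta> and m=m and L=L])
    show "continuous_on ({x0 - r..x0 + r} \<times> {t - \<delta>..t}) (\<lambda>(x, t). S x t)"
      by (rule continuous_on_subset[OF continuous_S]) (use sub(1) tT(2) in blast)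
  next
    fix x s assume xs: "x \<in> {x0 - r..x0 + r}" "s \<in> {t - \<delta>..t}"
    note x = sub[OF xs(1)] and s = tT[OF xs(2)]
    show "S x s - S y s \<le> 1" for y
      using S_le_1[OF s(2), of x] S_nonneg[OF s(2), of y] by simp
    show "((\<lambda>v. S v s) has_real_derivative - \<rho> x s) (at x)"
      by (rule S_has_derivative[OF s(2) x(1)])
    have D_der: "((\<lambda>v. D v s) has_real_derivative D' x s) (at x)"
      using D_has_derivative[OF s(2) x] by (simp add: D'_def)
    have "((\<lambda>v. a v s / D v s) has_real_derivative (J x s * D x s - a x s * D' x s) / (D x s * D x s)) (at x)"
      by (rule DERIV_divide[OF a_has_derivative[OF x(1) s(1)] D_der])
         (use Dpos[OF xs] in simp)
    moreover have "(J x s * D x s - a x s * D' x s) / (D x s * D x s) = q x s"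
      using Dpos[OF xs] by (simp add: q_def a_def field_simps)
    ultimately have quot: "((\<lambda>v. a v s / D v s) has_real_derivative q x s) (at x)" by simp
    have ev: "\<forall>\<^sub>F v in nhds x. a v s / D v s = \<rho> v s"
    proof -
      have "isCont (\<lambda>v. D v s) x" by (rule DERIV_isCont[OF D_der])
      then have "\<forall>\<^sub>F v in nhds x. 0 < D v s"
        using order_tendstoD(1)[of "\<lambda>v. D v s" "D x s" "nhds x" 0] Dpos[OF xs]
        by (simp add: tendsto_nhds_iff isCont_def)
      then show ?thesis by eventually_elim (simp add: a_def)
    qed
    show "((\<lambda>v. \<rho> v s) has_real_derivative q x s) (at x)"
      using DERIV_cong_ev[OF refl ev refl] quot by simp
    show "(S x has_real_derivative - (D' x s * \<rho> x s + D x s * q x s)) (at s)"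
      using S_has_time_derivative[OF s(1) x(1)] Dpos[OF xs] by (simp add: q_def)
    show "0 \<le> \<rho> x s" using rho_nonneg s x by simp
    have "D' x s \<le> \<gamma> / 2 * (if x < 1 then 2 * x else 1) * 1"
      unfolding D'_def using x gamma_pos by (intro mult_left_mono S_le_1 s) auto
    then show "D' x s \<le> L * m" using D'L[OF xs(1)] by simp
  qed (use assms D'0 in auto)
qed

text \<open>The gradient estimate at scale \<open>w\<close>, on \<open>{w/2..3*w/2}\<close>, has the
  barrier parameter \<open>k / w\<close>. All powers of \<open>w\<close> cancel in its condition, so
  one \<open>k\<close> serves every \<open>w\<close>; the resulting bound \<open>4 * k / w\<close>
  on the density is compensated by \<open>D \<le> \<gamma> / 2 * w\<close>.\<close>

lemma a_bounded_near_0: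
  assumes \<delta>: "0 < \<delta>" and \<sigma>: "0 < \<sigma>"
  shows "\<exists>C. \<forall>w t. 0 < w \<longrightarrow> w \<le> 1/2 \<longrightarrow> {t - \<delta>..t} \<subseteq> interior T \<longrightarrow>
    (\<forall>s\<in>{t - \<delta>..t}. \<sigma> \<le> S (3/4) s) \<longrightarrow> a w t \<le> C"
proof -
  obtain k where k: "1 \<le> k" "16 + 48 / \<sigma> + 8 / (\<delta> * \<gamma> * \<sigma>) < 16 * k\<^sup>2 - 48 / \<sigma> * k"
    using quadratic_dominates_linear[of "48 / \<sigma>" "16 + 48 / \<sigma> + 8 / (\<delta> * \<gamma> * \<sigma>)"] \<sigma> \<delta> gamma_pos by auto
  show ?thesis
  proof (intro exI[of _ "2 * \<gamma> * k"] allI impI)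
    fix w t :: real assume w: "0 < w" "w \<le> 1/2" and time: "{t - \<delta>..t} \<subseteq> interior T"
      and S: "\<forall>s\<in>{t - \<delta>..t}. \<sigma> \<le> S (3/4) s"
    have t: "t \<in> T" using interior_sub[OF subsetD[OF time]] \<delta> by simp
    have "\<rho> w t \<le> 4 * (k / w)"
    \<comment> \<open>\<open>m\<close> comes from \<open>D_lower\<close> at \<open>w/2\<close>;
      \<open>L\<close> is chosen so that \<open>L * m = \<gamma> * (3/2 * w)\<close>, the bound for
      the derivative of \<open>D\<close> at the right end \<open>3/2 * w\<close>.\<close>
    proof (rule rho_interior_bound[where r="w/2" and \<delta>=\<delta> and m="\<gamma> * \<sigma> * w\<^sup>2 / 8" and L="12 / (\<sigma> * w)"])
      fix x s assume x: "x \<in> {w - w/2..w + w/2}" and s: "s \<in> {t - \<delta>..t}"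
      have sT: "s \<in> T" using s time interior_sub by blast
      have "\<gamma> * \<sigma> * w\<^sup>2 / 8 = \<gamma> / 2 * ((w/2)\<^sup>2 * \<sigma>)" by (simp add: power2_eq_square)
      also have "\<dots> \<le> \<gamma> / 2 * (kap (w/2) * S (w/2) s)"
      proof (intro mult_left_mono mult_mono)
        show "\<sigma> \<le> S (w/2) s" using bspec[OF S s] S_antimono[OF sT, of "w/2" "3/4"] w by simp
      qed (use w gamma_pos \<sigma> in \<open>auto simp: kap_def\<close>)
      also have "\<dots> \<le> D x s" using x w by (intro D_lower sT) auto
      finally show "\<gamma> * \<sigma> * w\<^sup>2 / 8 \<le> D x s" .
    next
      fix x assume x: "x \<in> {w - w/2..w + w/2}"
      then have "\<gamma> / 2 * (if x < 1 then 2 * x else 1) \<le> \<gamma> * (3/2 * w)"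
        using w gamma_pos by (auto intro!: mult_left_mono)
      also have "\<dots> = 12 / (\<sigma> * w) * (\<gamma> * \<sigma> * w\<^sup>2 / 8)"
        using w \<sigma> by (simp add: power2_eq_square)
      finally show "\<gamma> / 2 * (if x < 1 then 2 * x else 1) \<le> 12 / (\<sigma> * w) * (\<gamma> * \<sigma> * w\<^sup>2 / 8)" .
    next
      have "1 < \<delta> * \<gamma> * \<sigma> / 8 * (16 * k\<^sup>2 - 16 - 48 / \<sigma> * k - 48 / \<sigma>)"
      proof -
        have "8 / (\<delta> * \<gamma> * \<sigma>) < 16 * k\<^sup>2 - 16 - 48 / \<sigma> * k - 48 / \<sigma>" using k(2) by linarith
        then have "\<delta> * \<gamma> * \<sigma> / 8 * (8 / (\<delta> * \<gamma> * \<sigma>)) < \<delta> * \<gamma> * \<sigma> / 8 * (16 * k\<^sup>2 - 16 - 48 / \<sigma> * k - 48 / \<sigma>)"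
          using \<delta> \<sigma> gamma_pos by (intro mult_strict_left_mono) auto
        then show ?thesis using \<delta> \<sigma> gamma_pos by simp
      qed
      also have "\<dots> = \<delta> * (\<gamma> * \<sigma> * w\<^sup>2 / 8) *
          (16 * (k / w)\<^sup>2 - 4 / (w/2)\<^sup>2 - 4 * (12 / (\<sigma> * w)) * (k / w) - 2 * (12 / (\<sigma> * w)) / (w/2))"
        using w \<sigma> by (simp add: field_simps power2_eq_square)
      finally show "1 < \<delta> * (\<gamma> * \<sigma> * w\<^sup>2 / 8) *
          (16 * (k / w)\<^sup>2 - 4 / (w/2)\<^sup>2 - 4 * (12 / (\<sigma> * w)) * (k / w) - 2 * (12 / (\<sigma> * w)) / (w/2))" .
    qed (use w \<delta> \<sigma> gamma_pos k time in auto)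
    then have "a w t \<le> (\<gamma> / 2 * kap w) * (4 * (k / w))"
      unfolding a_def using D_upper(2)[OF t w(1)] rho_nonneg[OF t w(1)] gamma_pos kap_bounds(1)[OF w(1)]
      by (intro mult_mono) auto
    also have "\<dots> \<le> (\<gamma> / 2 * w) * (4 * (k / w))"
      using kap_bounds(2)[of w] w k gamma_pos by (intro mult_right_mono mult_left_mono) auto
    also have "\<dots> = 2 * \<gamma> * k" using w by simp
    finally show "a w t \<le> 2 * \<gamma> * k" .
  qed
qed

text \<open>The gradient estimate at radius 1/2, on intervals that stay above 1.
  \<open>D_lower\<close> at 3/4 and slope at most \<open>\<gamma> / 2\<close> make its constants
  independent of \<open>w\<close>.\<close>

lemma a_bounded_at_top:
  assumes \<delta>: "0 < \<delta>" and \<sigma>: "0 < \<sigma>"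
  shows "\<exists>C. \<forall>w t. 2 \<le> w \<longrightarrow> {t - \<delta>..t} \<subseteq> interior T \<longrightarrow>
    (\<forall>s\<in>{t - \<delta>..t}. \<sigma> \<le> S (3/4) s) \<longrightarrow> a w t \<le> C"
proof -
  define m where "m = \<gamma> / 2 * (9/16 * \<sigma>)"
  define L where "L = 16 / (9 * \<sigma>)"
  have mL: "0 < m" "0 < L" "L * m = \<gamma> / 2" using \<sigma> gamma_pos by (auto simp: m_def L_def)
  obtain k where k: "1 \<le> k" "16 + 4 * L + 1 / (\<delta> * m) < 16 * k\<^sup>2 - 4 * L * k"
    using quadratic_dominates_linear[of "4 * L" "16 + 4 * L + 1 / (\<delta> * m)"] \<delta> mL by auto
  show ?thesis
  proof (intro exI[of _ "\<gamma> / 2 * (4 * k)"] allI impI)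
    fix w t :: real assume w: "2 \<le> w" and time: "{t - \<delta>..t} \<subseteq> interior T"
      and S: "\<forall>s\<in>{t - \<delta>..t}. \<sigma> \<le> S (3/4) s"
    have t: "t \<in> T" using interior_sub[OF subsetD[OF time]] \<delta> by simp
    have "\<rho> w t \<le> 4 * k"
    proof (rule rho_interior_bound[where r="1/2" and \<delta>=\<delta> and m=m and L=L])
      fix x s assume x: "x \<in> {w - 1/2..w + 1/2}" and s: "s \<in> {t - \<delta>..t}"
      have sT: "s \<in> T" using s time interior_sub by blast
      have "m \<le> \<gamma> / 2 * (kap (3/4) * S (3/4) s)"
        using bspec[OF S s] gamma_pos by (simp add: m_def kap_def power2_eq_square)
      also have "\<dots> \<le> D x s" using x w by (intro D_lower sT) auto
      finally show "m \<le> D x s" .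
    next
      have "1 / (\<delta> * m) < 16 * k\<^sup>2 - 4 / (1/2)\<^sup>2 - 4 * L * k - 2 * L / (1/2)"
        using k(2) by (simp add: power2_eq_square)
      then have "\<delta> * m * (1 / (\<delta> * m)) < \<delta> * m * (16 * k\<^sup>2 - 4 / (1/2)\<^sup>2 - 4 * L * k - 2 * L / (1/2))"
        using \<delta> mL by (intro mult_strict_left_mono) auto
      then show "1 < \<delta> * m * (16 * k\<^sup>2 - 4 / (1/2)\<^sup>2 - 4 * L * k - 2 * L / (1/2))"
        using \<delta> mL by simp
    qed (use w \<delta> mL k time in auto)
    then show "a w t \<le> \<gamma> / 2 * (4 * k)"
      unfolding a_def using D_upper(1)[OF t, of w] rho_nonneg[OF t, of w] gamma_pos w
      by (intro mult_mono) auto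
  qed
qed

text \<open>Small and large wealth are covered by the two estimates above, \<open>{1/2..2}\<close>,
  which contains the kink, by compactness. The constant \<sigma> is the minimum of
  \<open>S (3/4)\<close> over a compact time interval, positive by \<open>S_pos\<close>.\<close>

lemma a_locally_bounded:
  assumes "t0 \<in> interior T"
  shows "\<exists>C \<delta>. 0 < \<delta> \<and> {t0 - \<delta>..t0 + \<delta>} \<subseteq> interior T \<and>
    (\<forall>w t. 0 < w \<longrightarrow> t \<in> {t0 - \<delta>..t0 + \<delta>} \<longrightarrow> a w t \<le> C)"
proof -
  obtain e where e: "0 < e" "cball t0 e \<subseteq> interior T"
    using assms open_contains_cball[of "interior T"] by auto
  \<comment> \<open>Half the radius, so that every backward window \<open>{t - \<delta>..t}\<close>
    used below stays within \<open>I\<close>.\<close>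
  define \<delta> where "\<delta> = e / 2"
  define I where "I = {t0 - e..t0 + e}"
  have I: "I \<subseteq> interior T" "I \<subseteq> T" "0 < \<delta>"
    using e interior_subset[of T] by (auto simp: I_def cball_eq_atLeastAtMost \<delta>_def)
  have "continuous_on I (S (3/4))"
    by (rule continuous_on_subset[OF continuous_in_time[OF continuous_S]]) (use I in auto)
  then obtain s0 where s0: "s0 \<in> I" "\<And>s. s \<in> I \<Longrightarrow> S (3/4) s0 \<le> S (3/4) s"
    using continuous_attains_inf[of I "S (3/4)"] e by (auto simp: I_def)
  have \<sigma>: "0 < S (3/4) s0" using S_pos s0 I by auto
  obtain C1 where C1: "\<And>w t. 0 < w \<Longrightarrow> w \<le> 1/2 \<Longrightarrow> {t - \<delta>..t} \<subseteq> interior T \<Longrightarrow>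
    (\<forall>s\<in>{t - \<delta>..t}. S (3/4) s0 \<le> S (3/4) s) \<Longrightarrow> a w t \<le> C1"
    using a_bounded_near_0[OF I(3) \<sigma>] by metis
  obtain C2 where C2: "\<And>w t. 2 \<le> w \<Longrightarrow> {t - \<delta>..t} \<subseteq> interior T \<Longrightarrow>
    (\<forall>s\<in>{t - \<delta>..t}. S (3/4) s0 \<le> S (3/4) s) \<Longrightarrow> a w t \<le> C2"
    using a_bounded_at_top[OF I(3) \<sigma>] by metis
  have "continuous_on ({1/2..2} \<times> I) (\<lambda>(w, t). a w t)"
    by (rule continuous_on_subset[OF continuous_a]) (use I in auto)
  moreover have "compact ({1/2..2 :: real} \<times> I)" unfolding I_def by (intro compact_Times compact_Icc)
  moreover have "{1/2..2 :: real} \<times> I \<noteq> {}" using s0 by auto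
  ultimately obtain z where z: "\<And>z'. z' \<in> {1/2..2} \<times> I \<Longrightarrow> (\<lambda>(w, t). a w t) z' \<le> (\<lambda>(w, t). a w t) z"
    using continuous_attains_sup[of "{1/2..2} \<times> I" "\<lambda>(w, t). a w t"] by metis
  define C3 where "C3 = (\<lambda>(w, t). a w t) z"
  show ?thesis
  proof (rule exI[of _ "max C1 (max C2 C3)"], rule exI[of _ \<delta>], intro conjI allI impI)
    show "0 < \<delta>" by (rule I)
    show "{t0 - \<delta>..t0 + \<delta>} \<subseteq> interior T" using I e by (auto simp: I_def \<delta>_def)
    fix w t :: real assume w: "0 < w" and t: "t \<in> {t0 - \<delta>..t0 + \<delta>}"
    have tI: "{t - \<delta>..t} \<subseteq> I" using t e by (auto simp: I_def \<delta>_def)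
    have tS: "\<forall>s\<in>{t - \<delta>..t}. S (3/4) s0 \<le> S (3/4) s" using s0(2) tI by blast
    have tU: "{t - \<delta>..t} \<subseteq> interior T" using tI I by auto
    consider "w \<le> 1/2" | "2 \<le> w" | "w \<in> {1/2..2}" by fastforce
    then show "a w t \<le> max C1 (max C2 C3)"
    proof cases
      case 1
      then show ?thesis using C1[OF w 1 tU tS] by simp
    next
      case 2
      then show ?thesis using C2[OF 2 tU tS] by simp
    next
      case 3
      have "t \<in> I" using tI I by auto
      then show ?thesis using z[of "(w, t)"] 3 by (simp add: C3_def)
    qed
  qed
qed

subsection \<open>The Gini coefficient\<close>

lemma K_bounds:
  assumes "t \<in> T" "0 < w" shows "0 \<le> K w t" "K w t \<le> 1"
proof -
  have *: "0 \<le> min w x * p t x" "min w x * p t x \<le> x * p t x" for x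
    using assms p_nonneg[OF assms(1), of x] p_zero[OF assms(1), of x]
    by (cases "0 < x"; auto intro!: mult_right_mono)+
  show "0 \<le> K w t" unfolding K_def by (intro integral_nonneg_AE AE_I2 *)
  have "K w t \<le> (\<integral>x. x * p t x \<partial>lborel)" unfolding K_def
    by (intro integral_mono integrable_min_p integrable_xp assms *)
  then show "K w t \<le> 1" using integral_xp assms by simp
qed

lemma K_measurable: "t \<in> T \<Longrightarrow> (\<lambda>w. K w t) \<in> borel_measurable borel"
proof -
  assume "t \<in> T"
  note [measurable] = p_measurable[OF this]
  show ?thesis unfolding K_def by measurable
qed

lemma D_measurable: "t \<in> T \<Longrightarrow> (\<lambda>w. D w t) \<in> borel_measurable borel"
proof -
  assume "t \<in> T"
  note [measurable] = p_measurable[OF this]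
  show ?thesis unfolding D_eq by measurable
qed

lemma integrable_K_p: "s \<in> T \<Longrightarrow> t \<in> T \<Longrightarrow> integrable lborel (\<lambda>w. K w s * p t w)"
  by (rule integrable_mult_p[where C=0 and C'=1])
     (use K_bounds in \<open>auto intro: K_measurable\<close>)

lemma K_p_symmetric:
  assumes s: "s \<in> T" and t: "t \<in> T"
  shows "(\<integral>w. K w s * p t w \<partial>lborel) = (\<integral>w. K w t * p s w \<partial>lborel)"
proof -
  note [measurable] = p_measurable[OF s] p_measurable[OF t]
  \<comment> \<open>\<open>p t w * (x * p s x)\<close> factorizes and dominates the kernel integrand
    by \<open>min w x \<le> x\<close>, which justifies Fubini.\<close>
  have "integrable (lborel \<Otimes>\<^sub>M lborel) (\<lambda>z. p t (fst z) * (snd z * p s (snd z)))"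
  proof (rule lborel_pair.Fubini_integrable)
    show "integrable lborel (\<lambda>x. \<integral>y. norm (p t (fst (x, y)) * (snd (x, y) * p s (snd (x, y)))) \<partial>lborel)"
      using integrable_p[OF t] by (simp add: abs_mult)
    show "AE x in lborel. integrable lborel (\<lambda>y. p t (fst (x, y)) * (snd (x, y) * p s (snd (x, y))))"
      using integrable_xp[OF s] by simp
  qed measurable
  then have "integrable (lborel \<Otimes>\<^sub>M lborel) (\<lambda>(w, x). min w x * p s x * p t w)"
  proof (rule Bochner_Integration.integrable_bound)
    have "norm (min w x * p s x * p t w) \<le> norm (p t w * (x * p s x))" for w x
    proof (cases "0 < w \<and> 0 < x")
      case True
      then have "min w x * (p s x * p t w) \<le> x * (p s x * p t w)"
        using p_nonneg[OF s, of x] p_nonneg[OF t, of w] by (intro mult_right_mono) auto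
      then show ?thesis using True p_nonneg[OF s, of x] p_nonneg[OF t, of w]
        by (simp add: abs_mult mult_ac)
    qed (use p_zero[OF s, of x] p_zero[OF t, of w] in auto)
    then show "AE z in lborel \<Otimes>\<^sub>M lborel. norm (case z of (w, x) \<Rightarrow> min w x * p s x * p t w)
        \<le> norm (p t (fst z) * (snd z * p s (snd z)))"
      by (simp add: split_beta)
  qed measurable
  from lborel_pair.Fubini_integral[OF this]
  have "(\<integral>x. (\<integral>w. min w x * p s x * p t w \<partial>lborel) \<partial>lborel) =
      (\<integral>w. (\<integral>x. min w x * p s x * p t w \<partial>lborel) \<partial>lborel)" .
  moreover have "(\<integral>w. min w x * p s x * p t w \<partial>lborel) = K x t * p s x" for x
  proof -
    have "(\<integral>w. min w x * p s x * p t w \<partial>lborel) = (\<integral>w. min x w * p t w * p s x \<partial>lborel)"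
      by (intro Bochner_Integration.integral_cong) (auto simp: min.commute)
    then show ?thesis by (simp add: K_def)
  qed
  ultimately show ?thesis by (simp add: K_def)
qed

lemma gini_eq: "gini (\<lambda>w. \<rho> w t) = 1 - (\<integral>w. K w t * p t w \<partial>lborel)"
proof -
  have "indicator {0<..} w *\<^sub>R (\<integral>x. indicator {0<..} x *\<^sub>R (min w x * \<rho> w t * \<rho> x t) \<partial>lborel) = K w t * p t w" for w
  proof -
    have "(\<integral>x. indicator {0<..} x *\<^sub>R (min w x * \<rho> w t * \<rho> x t) \<partial>lborel) = (\<integral>x. min w x * p t x * \<rho> w t \<partial>lborel)"
      by (intro Bochner_Integration.integral_cong) (auto simp: p_def)
    then show ?thesis by (simp add: K_def p_def)
  qed
  then show ?thesis by (simp add: gini_def set_lebesgue_integral_def)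
qed

text \<open>A difference of two squares for the symmetric bilinear form with kernel
  \<open>min\<close>: the cross terms cancel by \<open>K_p_symmetric\<close>.\<close>

lemma gini_diff:
  assumes s: "s \<in> T" and t: "t \<in> T"
  shows "gini (\<lambda>w. \<rho> w t) - gini (\<lambda>w. \<rho> w s) =
    (\<integral>w. (K w s - K w t) * p s w \<partial>lborel) + (\<integral>w. (K w s - K w t) * p t w \<partial>lborel)"
  using integrable_K_p[OF s s] integrable_K_p[OF s t] integrable_K_p[OF t s] integrable_K_p[OF t t]
    K_p_symmetric[OF s t]
  by (simp add: gini_eq left_diff_distrib)

text \<open>The time derivative \<open>- a\<close> is nonpositive in the interior; continuity of
  \<open>K\<close> on all of \<open>T\<close> extends this to end points.\<close>

lemma K_antimono:
  assumes "s \<in> T" "t \<in> T" "s \<le> t" "0 < w" shows "K w t \<le> K w s"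
proof -
  have sub: "{s..t} \<subseteq> T"
    using interval assms unfolding is_interval_1 by (meson atLeastAtMost_iff subsetI)
  show ?thesis
  proof (rule DERIV_nonpos_imp_decreasing_open[OF assms(3)])
    show "continuous_on {s..t} (K w)"
      by (rule continuous_on_subset[OF continuous_in_time[OF continuous_K assms(4)] sub])
    fix \<tau> assume "s < \<tau>" "\<tau> < t"
    then have \<tau>: "\<tau> \<in> interior T"
      using interior_mono[OF sub] by (auto simp: interior_atLeastAtMost_real)
    show "\<exists>y. (K w has_real_derivative y) (at \<tau>) \<and> y \<le> 0"
      using K_has_time_derivative[OF \<tau> assms(4)] a_nonneg[OF interior_sub[OF \<tau>] assms(4)]
      by (intro exI[of _ "- a w \<tau>"]) simp
  qed
qed

lemma gini_mono: "mono_on T (\<lambda>t. gini (\<lambda>w. \<rho> w t))"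
proof (rule mono_onI)
  fix s t assume st: "s \<in> T" "t \<in> T" "s \<le> t"
  have "0 \<le> (K w s - K w t) * p \<tau> w" if "\<tau> \<in> T" for w \<tau>
    using K_antimono[OF st, of w] p_nonneg[OF that, of w] p_zero[OF that, of w]
    by (cases "0 < w") auto
  then have "0 \<le> (\<integral>w. (K w s - K w t) * p s w \<partial>lborel) + (\<integral>w. (K w s - K w t) * p t w \<partial>lborel)"
    using st by (intro add_nonneg_nonneg integral_nonneg_AE AE_I2)
  then show "gini (\<lambda>w. \<rho> w s) \<le> gini (\<lambda>w. \<rho> w t)" using gini_diff[OF st(1,2)] by simp
qed

text \<open>By the mean value theorem the quotient is a value of \<open>a\<close> at an intermediate
  time, so the bound on \<open>a\<close> makes the quotients uniformly bounded for the passage to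
  the limit.\<close>

lemma K_difference_quotient_bound:
  assumes I: "\<And>\<tau>. \<tau> \<in> I \<Longrightarrow> \<tau> \<in> interior T \<and> a w \<tau> \<le> C" "is_interval I"
    and st: "s \<in> I" "t \<in> I" and "0 < w"
  shows "\<bar>(K w s - K w t) / (t - s)\<bar> \<le> C"
proof -
  have C: "0 \<le> C"
    using I(1)[OF st(1)] a_nonneg[OF interior_sub, of s w] \<open>0 < w\<close> by force
  have *: "\<bar>(K w s - K w t) / (t - s)\<bar> \<le> C" if "s \<in> I" "t \<in> I" "s < t" for s t
  proof -
    have sub: "\<tau> \<in> I" if "s \<le> \<tau>" "\<tau> \<le> t" for \<tau>
      using I(2) \<open>s \<in> I\<close> \<open>t \<in> I\<close> that unfolding is_interval_1 by blast
    have "\<exists>z>s. z < t \<and> K w t - K w s = (t - s) * - a w z"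
      by (rule MVT2[OF \<open>s < t\<close>]) (use sub I(1) K_has_time_derivative \<open>0 < w\<close> in blast)
    then obtain z where z: "s < z" "z < t" "K w t - K w s = (t - s) * - a w z" by blast
    then have "(K w s - K w t) / (t - s) = a w z" using \<open>s < t\<close> by (simp add: field_simps)
    moreover have "0 \<le> a w z" "a w z \<le> C"
      using I(1)[of z] sub[of z] z a_nonneg[of z w] interior_sub \<open>0 < w\<close> by auto
    ultimately show ?thesis by simp
  qed
  consider "s < t" | "t < s" | "s = t" by linarith
  then show ?thesis
  proof cases
    case 2
    have "(K w s - K w t) / (t - s) = (K w t - K w s) / (s - t)" using 2 by (simp add: field_simps)
    then show ?thesis using *[OF st(2,1) 2] by simp
  qed (use * st C in auto)
qed

lemma gini_has_derivative:
  assumes "t0 \<in> interior T"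
  shows "((\<lambda>t. gini (\<lambda>w. \<rho> w t)) has_real_derivative
    2 * (\<integral>x. a x t0 * p t0 x \<partial>lborel)) (at t0)"
proof -
  obtain C \<delta> where \<delta>: "0 < \<delta>" "{t0 - \<delta>..t0 + \<delta>} \<subseteq> interior T"
    and C: "\<And>w t. 0 < w \<Longrightarrow> t \<in> {t0 - \<delta>..t0 + \<delta>} \<Longrightarrow> a w t \<le> C"
    using a_locally_bounded[OF assms] by metis
  define I where "I = {t0 - \<delta><..<t0 + \<delta>}"
  have I: "open I" "t0 \<in> I" "is_interval I" "I \<subseteq> interior T"
    using \<delta> by (auto simp: I_def is_interval_convex_1)
  then have IT: "I \<subseteq> T" using interior_subset by blast
  define Q where "Q = (\<lambda>t. (gini (\<lambda>w. \<rho> w t) - gini (\<lambda>w. \<rho> w t0)) / (t - t0))"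
  have "(Q \<longlongrightarrow> 2 * (\<integral>x. a x t0 * p t0 x \<partial>lborel)) (at t0 within I)"
    unfolding tendsto_at_iff_sequentially
  proof (intro allI impI)
    fix u :: "nat \<Rightarrow> real" assume u: "\<forall>i. u i \<in> I - {t0}" "u \<longlonglongrightarrow> t0"
    have uI: "u n \<in> I" "u n \<in> T" "u n \<noteq> t0" for n using u(1)[rule_format, of n] IT by auto
    have t0: "t0 \<in> T" using I(2) IT by blast
    define g where "g = (\<lambda>n x. (K x t0 - K x (u n)) / (u n - t0))"
    \<comment> \<open>Equal to \<open>a\<close> on the half-line and zero elsewhere; written with
      \<open>p t0\<close> in place of \<rho> so that it is measurable on the whole line.\<close>
    define h where "h = (\<lambda>x. D x t0 * p t0 x)"
    have gm: "g n \<in> borel_measurable borel" for n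
      unfolding g_def
      by (intro borel_measurable_divide borel_measurable_diff K_measurable t0 uI borel_measurable_const)
    have hm: "h \<in> borel_measurable borel"
      unfolding h_def by (intro borel_measurable_times D_measurable p_measurable t0)
    have gb: "\<bar>g n x\<bar> \<le> C" if "0 < x" for n x
      unfolding g_def
      by (rule K_difference_quotient_bound[of I]) (use I C uI that in \<open>auto simp: I_def\<close>)
    have gl: "(\<lambda>n. g n x) \<longlonglongrightarrow> h x" if "0 < x" for x
    proof -
      have "((\<lambda>t. (K x t - K x t0) / (t - t0)) \<longlongrightarrow> - a x t0) (at t0)"
        using K_has_time_derivative[OF assms that] by (simp add: has_field_derivative_iff)
      then have "(\<lambda>n. (K x (u n) - K x t0) / (u n - t0)) \<longlonglongrightarrow> - a x t0"
        using u(2) uI by (auto simp: tendsto_at_iff_sequentially o_def)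
      then have "(\<lambda>n. - ((K x (u n) - K x t0) / (u n - t0))) \<longlonglongrightarrow> - (- a x t0)"
        by (rule tendsto_minus)
      moreover have "- ((K x (u n) - K x t0) / (u n - t0)) = g n x" for n
        by (simp add: g_def minus_divide_left)
      moreover have "h x = a x t0" using that by (simp add: h_def a_def p_def)
      ultimately show ?thesis by simp
    qed
    \<comment> \<open>By \<open>gini_diff\<close> the quotient of the Gini coefficient is a sum of
      two integrals, one against the fixed density and one against the moving one. Both have the
      same limit, hence the factor 2.\<close>
    have "(\<lambda>n. (\<integral>x. g n x * p t0 x \<partial>lborel) + (\<integral>x. g n x * p (u n) x \<partial>lborel)) \<longlonglongrightarrow>
        (\<integral>x. h x * p t0 x \<partial>lborel) + (\<integral>x. h x * p t0 x \<partial>lborel)"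
      by (intro tendsto_add tendsto_integral_p[where C=C] gm hm gb AE_I2 impI gl u t0 uI tendsto_const)
    moreover have "(\<integral>x. g n x * p t0 x \<partial>lborel) + (\<integral>x. g n x * p (u n) x \<partial>lborel) = Q (u n)" for n
      unfolding Q_def gini_diff[OF t0 uI(2)] g_def by (simp add: add_divide_distrib)
    moreover have "(\<lambda>x. h x * p t0 x) = (\<lambda>x. a x t0 * p t0 x)"
      by (auto simp: h_def a_def p_def indicator_def)
    ultimately show "(Q \<circ> u) \<longlonglongrightarrow> 2 * (\<integral>x. a x t0 * p t0 x \<partial>lborel)"
      by (simp add: o_def)
  qed
  then show ?thesis
    unfolding has_field_derivative_iff Q_def by (simp add: at_within_open[OF I(2,1)])
qed

end

theorem theorem4p1:
  fixes \<gamma> :: real and T :: "real set" and \<rho> :: "real \<Rightarrow> real \<Rightarrow> real"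
  assumes "0 < \<gamma>" and "\<gamma> < 1"
    and "is_interval T"
    and "modified_ysm_solution \<gamma> T \<rho>"
  shows "mono_on T (\<lambda>t. gini (\<lambda>w. \<rho> w t)) \<and>
         (\<forall>t\<in>interior T. \<exists>d\<ge>0. ((\<lambda>s. gini (\<lambda>w. \<rho> w s)) has_real_derivative d) (at t))"
proof -
  obtain \<rho>t J where "ysm_solution \<gamma> T \<rho> \<rho>t J"
    using assms unfolding modified_ysm_solution_def ysm_solution_def by blast
  then interpret ysm_solution \<gamma> T \<rho> \<rho>t J .
  have "0 \<le> 2 * (\<integral>x. a x t * p t x \<partial>lborel)" if "t \<in> interior T" for t
  proof -
    have "0 \<le> a x t * p t x" for x
      using a_nonneg[OF interior_sub[OF that], of x] p_nonneg[OF interior_sub[OF that], of x]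
        p_zero[OF interior_sub[OF that], of x] by (cases "0 < x") auto
    then show ?thesis by simp
  qed
  then show ?thesis using gini_mono gini_has_derivative by blast
qed

end
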